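(* Suppose $A=\{\pi_1,\dots,\pi_7\}\subset\mathbb R^2$ is a set of seven distinct points, with no four $\pi_i$'s on a line and not all seven on one quadratic. Then Hilbert's Method (with $d=3$) applies to $A$.
   Context: Points "lie on a quadratic" if some nonzero real polynomial in $x,y$ of degree at most $2$ vanishes at all of them. A real polynomial $p(x,y)$ is positive (psd) if $p(a)\ge0$ for all $a\in\mathbb R^2$, and sos if it is a finite sum of squares of real polynomials. For a finite set $A\subset\mathbb R^2$: $I_{1,3}(A)$ is the vector space of real polynomials in $x,y$ of degree $\le 3$ vanishing on $A$; $I_{2,6}(A)$ is the vector space of real polynomials of degree $\le 6$ that vanish together with both first partial derivatives at every point of $A$; $I_{1,3}^2(A)$ is the set of finite sums $\sum_i h_ik_i$ with $h_i,k_i\in I_{1,3}(A)$. $\tilde A$ is the set of common real zeros in $\mathbb R^2$ of all elements of $I_{1,3}(A)$ that are not in $A$. $A$ is full if for every $\pi\in A$ and $v\in\mathbb R^2$ there is $h\in I_{1,3}(A)$ with $\vec\nabla h(\pi)=v$. A polynomial $f$ of degree $m$ has a zero at infinity if its homogenization $z^mf(x/z,y/z)$ vanishes at some $(a,b,0)\ne(0,0,0)$ with $a,b$ real. "Hilbert's Method applies to $A$" (with $d=3$) means: for a basis $\{h_1,\dots,h_s\}$ of $I_{1,3}(A)$, the set $\tilde A$ is finite, $A$ is full, $\sum_j h_j^2$ has no zeros at infinity, and there exists $g\in I_{2,6}(A)\smallsetminus I_{1,3}^2(A)$ with $g(w)>0$ for every $w\in\tilde A$; and thus there is $c>0$ such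 that $\sum_j h_j^2+cg$ is positive and not sos. *)

theory Defs
  imports "HOL-Analysis.Analysis" "HOL-Computational_Algebra.Polynomial"
begin

text \<open>
  The ring of real polynomials in two variables is \<open>real poly poly\<close>, read as \<open>\<real>[x][y]\<close>:
  the coefficient of \<open>x\<^sup>i y\<^sup>j\<close> in \<open>p\<close> is \<open>coeff (coeff p j) i\<close>.
\<close>

type_synonym bpoly = "real poly poly"

definition beval :: "bpoly \<Rightarrow> real \<times> real \<Rightarrow> real" where
  "beval p a = poly (poly p [:snd a:]) (fst a)"

definition partial_x :: "bpoly \<Rightarrow> bpoly" where
  "partial_x p = map_poly pderiv p"

definition partial_y :: "bpoly \<Rightarrow> bpoly" where
  "partial_y p = pderiv p"

definition grad :: "bpoly \<Rightarrow> real \<times> real \<Rightarrow> real \<times> real" where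
  "grad p a = (beval (partial_x p) a, beval (partial_y p) a)"

definition total_degree :: "bpoly \<Rightarrow> nat" where
  "total_degree p = (LEAST m. \<forall>i j. coeff (coeff p j) i \<noteq> 0 \<longrightarrow> i + j \<le> m)"

definition homogenization :: "bpoly \<Rightarrow> real \<Rightarrow> real \<Rightarrow> real \<Rightarrow> real" where
  "homogenization p x y z =
     (\<Sum>j\<le>total_degree p. \<Sum>i\<le>total_degree p - j.
        coeff (coeff p j) i * x ^ i * y ^ j * z ^ (total_degree p - (i + j)))"

definition has_zero_at_infinity :: "bpoly \<Rightarrow> bool" where
  "has_zero_at_infinity p \<longleftrightarrow> (\<exists>a b. (a, b) \<noteq> (0, 0) \<and> homogenization p a b 0 = 0)"

definition on_quadratic :: "(real \<times> real) set \<Rightarrow> bool" where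
  "on_quadratic A \<longleftrightarrow> (\<exists>q. q \<noteq> 0 \<and> total_degree q \<le> 2 \<and> (\<forall>a\<in>A. beval q a = 0))"

definition psd :: "bpoly \<Rightarrow> bool" where
  "psd p \<longleftrightarrow> (\<forall>a. beval p a \<ge> 0)"

definition sos :: "bpoly \<Rightarrow> bool" where
  "sos p \<longleftrightarrow> (\<exists>(n::nat) q. p = (\<Sum>i<n. (q i)\<^sup>2))"

definition I13 :: "(real \<times> real) set \<Rightarrow> bpoly set" where
  "I13 A = {p. total_degree p \<le> 3 \<and> (\<forall>a\<in>A. beval p a = 0)}"

definition I26 :: "(real \<times> real) set \<Rightarrow> bpoly set" where
  "I26 A = {p. total_degree p \<le> 6 \<and>
     (\<forall>a\<in>A. beval p a = 0 \<and> beval (partial_x p) a = 0 \<and> beval (partial_y p) a = 0)}"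

definition I13_sq :: "(real \<times> real) set \<Rightarrow> bpoly set" where
  "I13_sq A = {f. \<exists>(n::nat) h k. (\<forall>i<n. h i \<in> I13 A \<and> k i \<in> I13 A) \<and> f = (\<Sum>i<n. h i * k i)}"

definition extra_zeros :: "(real \<times> real) set \<Rightarrow> (real \<times> real) set" where
  "extra_zeros A = {w. \<forall>h\<in>I13 A. beval h w = 0} - A"

definition full :: "(real \<times> real) set \<Rightarrow> bool" where
  "full A \<longleftrightarrow> (\<forall>\<pi>\<in>A. \<forall>v. \<exists>h\<in>I13 A. grad h \<pi> = v)"

definition bscale :: "real \<Rightarrow> bpoly \<Rightarrow> bpoly" where
  "bscale c p = smult [:c:] p"

global_interpretation bpoly: vector_space bscale
proof
  show "bscale (a + b) x = bscale a x + bscale b x" for a b x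
    using smult_add_left[of "[:a:]" "[:b:]" x] by (simp add: bscale_def)
qed (simp_all add: bscale_def smult_add_right mult.commute flip: one_pCons)

definition basis_of :: "bpoly set \<Rightarrow> bpoly set \<Rightarrow> bool" where
  "basis_of H V \<longleftrightarrow> finite H \<and> bpoly.independent H \<and> bpoly.span H = V"

text \<open>
  Every basis of \<open>I13 A\<close> is admitted here; \<open>I13_basis_exists\<close> below shows that there is one, so
  the quantification is not vacuous.
\<close>

definition hilbert_method_applies :: "(real \<times> real) set \<Rightarrow> bool" where
  "hilbert_method_applies A \<longleftrightarrow>
     (\<forall>H. basis_of H (I13 A) \<longrightarrow>
        finite (extra_zeros A) \<and>
        full A \<and>
        \<not> has_zero_at_infinity (\<Sum>h\<in>H. h\<^sup>2) \<and>
        (\<exists>g \<in> I26 A - I13_sq A.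
           (\<forall>w\<in>extra_zeros A. beval g w > 0) \<and>
           (\<exists>c>0. psd ((\<Sum>h\<in>H. h\<^sup>2) + bscale c g) \<and> \<not> sos ((\<Sum>h\<in>H. h\<^sup>2) + bscale c g))))"

lemma total_degree_bound_exists:
  "\<exists>m. \<forall>i j. coeff (coeff p j) i \<noteq> 0 \<longrightarrow> i + j \<le> m" for p :: bpoly
proof -
  let ?m = "degree p + (\<Sum>j\<le>degree p. degree (coeff p j))"
  have "i + j \<le> ?m" if "coeff (coeff p j) i \<noteq> 0" for i j
  proof -
    have j: "j \<le> degree p" using that by (metis coeff_0 le_degree)
    have "i \<le> degree (coeff p j)" using that le_degree by blast
    also have "\<dots> \<le> (\<Sum>j\<le>degree p. degree (coeff p j))"
      using j by (intro member_le_sum) auto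
    finally show ?thesis using j by linarith
  qed
  then show ?thesis by blast
qed

lemma total_degree_le_iff:
  "total_degree p \<le> n \<longleftrightarrow> (\<forall>i j. coeff (coeff p j) i \<noteq> 0 \<longrightarrow> i + j \<le> n)"
proof
  define P where "P m \<longleftrightarrow> (\<forall>i j. coeff (coeff p j) i \<noteq> 0 \<longrightarrow> i + j \<le> m)" for m
  have td: "total_degree p = (LEAST m. P m)" by (simp add: total_degree_def P_def)
  have "\<exists>m. P m" unfolding P_def by (rule total_degree_bound_exists)
  then have "P (total_degree p)" unfolding td by (rule LeastI_ex)
  then show "\<forall>i j. coeff (coeff p j) i \<noteq> 0 \<longrightarrow> i + j \<le> n" if "total_degree p \<le> n"
    using that unfolding P_def by (meson order_trans)
  show "total_degree p \<le> n" if "\<forall>i j. coeff (coeff p j) i \<noteq> 0 \<longrightarrow> i + j \<le> n"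
    unfolding td by (rule Least_le) (simp add: P_def that)
qed

lemma poly_eq_sum_atMost:
  fixes p :: "'a::comm_ring_1 poly"
  assumes "degree p \<le> n"
  shows "poly p x = (\<Sum>i\<le>n. coeff p i * x ^ i)"
  unfolding poly_altdef using assms
  by (intro sum.mono_neutral_left) (auto simp: coeff_eq_0)

lemma beval_sum:
  assumes "total_degree p \<le> n"
  shows "beval p (x, y) = (\<Sum>j\<le>n. \<Sum>i\<le>n - j. coeff (coeff p j) i * x ^ i * y ^ j)"
proof -
  have c0: "coeff (coeff p j) i = 0" if "i + j > n" for i j
    using assms that unfolding total_degree_le_iff by (meson not_le)
  have dp: "degree p \<le> n"
    by (rule degree_le) (auto intro!: poly_eqI c0)
  have dc: "degree (coeff p j) \<le> n - j" for j
    by (rule degree_le) (auto intro!: c0)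
  have "beval p (x, y) = poly (\<Sum>j\<le>n. coeff p j * [:y:] ^ j) x"
    by (simp add: beval_def poly_eq_sum_atMost[OF dp])
  also have "\<dots> = (\<Sum>j\<le>n. poly (coeff p j) x * y ^ j)"
    by (simp add: poly_sum)
  also have "\<dots> = (\<Sum>j\<le>n. \<Sum>i\<le>n - j. coeff (coeff p j) i * x ^ i * y ^ j)"
    by (simp add: poly_eq_sum_atMost[OF dc] sum_distrib_right)
  finally show ?thesis .
qed

lemma homogenization_eq:
  assumes "z \<noteq> 0"
  shows "homogenization p x y z = z ^ total_degree p * beval p (x / z, y / z)"
proof -
  let ?m = "total_degree p"
  have "z ^ (?m - (i + j)) = z ^ ?m / (z ^ i * z ^ j)" if "j \<le> ?m" "i \<le> ?m - j" for i j
    using that assms by (simp add: power_diff power_add)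
  then show ?thesis
    unfolding homogenization_def beval_sum[OF order_refl] sum_distrib_left
    by (intro sum.cong refl) (simp add: power_divide)
qed

lemma I13_basis_exists: "\<exists>H. basis_of H (I13 A)"
proof -
  have sub: "bpoly.subspace (I13 A)"
  proof (rule bpoly.subspaceI)
    show "0 \<in> I13 A" by (simp add: I13_def total_degree_le_iff beval_def)
    show "p + q \<in> I13 A" if p: "p \<in> I13 A" and q: "q \<in> I13 A" for p q
    proof -
      have "i + j \<le> 3" if "coeff (coeff (p + q) j) i \<noteq> 0" for i j
      proof -
        have "coeff (coeff p j) i \<noteq> 0 \<or> coeff (coeff q j) i \<noteq> 0" using that by auto
        then show ?thesis using p q by (auto simp: I13_def total_degree_le_iff)
      qed
      then have "total_degree (p + q) \<le> 3" unfolding total_degree_le_iff by blast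
      then show ?thesis using p q by (simp add: I13_def beval_def)
    qed
    show "bscale c p \<in> I13 A" if "p \<in> I13 A" for c p
      using that by (auto simp: I13_def total_degree_le_iff beval_def bscale_def)
  qed
  let ?mon = "\<lambda>(i, j). monom (monom (1::real) i) j"
  let ?M = "?mon ` ({..3::nat} \<times> {..3::nat})"
  have "p \<in> bpoly.span ?M" if "p \<in> I13 A" for p
  proof -
    have td: "total_degree p \<le> 3" using that by (simp add: I13_def)
    have c0: "coeff (coeff p j) i = 0" if "i + j > 3" for i j
      using td that unfolding total_degree_le_iff by (meson not_le)
    have eq: "p = (\<Sum>(i, j)\<in>{..3} \<times> {..3}. bscale (coeff (coeff p j) i) (?mon (i, j)))"
    proof (intro poly_eqI)
      fix j i
      have "coeff (coeff (\<Sum>(i, j)\<in>{..3} \<times> {..3}. bscale (coeff (coeff p j) i) (?mon (i, j))) j) i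
          = (\<Sum>t\<in>{..3} \<times> {..3}. if t = (i, j) then coeff (coeff p j) i else 0)"
        unfolding coeff_sum
        by (intro sum.cong refl) (auto simp: bscale_def coeff_monom split: if_splits)
      also have "\<dots> = coeff (coeff p j) i"
        using c0 by (auto simp: not_le)
      finally show "coeff (coeff p j) i = coeff (coeff
          (\<Sum>(i, j)\<in>{..3} \<times> {..3}. bscale (coeff (coeff p j) i) (?mon (i, j))) j) i" by simp
    qed
    show ?thesis
    proof (subst eq, rule bpoly.span_sum)
      fix t :: "nat \<times> nat" assume t: "t \<in> {..3} \<times> {..3}"
      have "bscale c (?mon t) \<in> bpoly.span ?M" for c
        using t by (rule bpoly.span_scale[OF bpoly.span_base[OF imageI]])
      then show "(case t of (i, j) \<Rightarrow> bscale (coeff (coeff p j) i) (?mon (i, j))) \<in> bpoly.span ?M"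
        by (cases t) simp
    qed
  qed
  then have le: "I13 A \<subseteq> bpoly.span ?M" by blast
  obtain B where B: "B \<subseteq> I13 A" "bpoly.independent B" "I13 A \<subseteq> bpoly.span B"
    by (rule bpoly.basis_exists[of "I13 A"])
  have "finite ?M" by (intro finite_imageI finite_cartesian_product finite_atMost)
  moreover have "B \<subseteq> bpoly.span ?M" using B(1) le by (rule subset_trans)
  ultimately have "finite B"
    by (rule bpoly.independent_span_bound[OF _ B(2), THEN conjunct1])
  moreover have "bpoly.span B = I13 A"
    using bpoly.span_minimal[OF B(1) sub] B(3) by (rule subset_antisym)
  ultimately show ?thesis using B(2) unfolding basis_of_def by blast
qed

end

theory Submission imports Defs begin

text \<open>
  Let \<open>w\<close> be a point of the projective plane outside \<open>A\<close>, and suppose every cubic through \<open>A\<close>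
  vanishes at \<open>w\<close>. If \<open>w\<close> is not on the line \<open>pq\<close> for \<open>p, q\<close> in \<open>A\<close>, then the product of
  this line and a conic through \<open>A - {p, q}\<close> is such a cubic, so that this conic passes through \<open>w\<close>.
  A conic is determined by five points no four of which are collinear; hence the conics for \<open>{p, q}\<close>
  and \<open>{p, r}\<close> agree for suitable \<open>q, r\<close> and contain \<open>A - {p}\<close>, and two such \<open>p\<close> yield a conic
  through \<open>A\<close>, a contradiction. So there are no extra zeros, neither in the plane nor at infinity; a
  tangent direction at a point of \<open>A\<close> in place of \<open>w\<close> gives fullness. The same products of lines
  show that \<open>I13 A\<close> has dimension at most 3, hence \<open>I13_sq A\<close> lies in a space of dimension 6,
  whereas \<open>I26 A\<close> has dimension at least \<open>28 - 21 = 7\<close>; this provides \<open>g\<close>. Finally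
  \<open>\<bar>g\<bar> \<le> M \<Sum>h\<^sup>2\<close> holds locally, by fullness near \<open>A\<close> and by positivity elsewhere, hence
  everywhere by compactness of the projective plane.
\<close>

section \<open>Linear functionals on spaces of polynomials\<close>

text \<open>\<open>T\<close> is allowed to lie outside \<open>S\<close>, so that the bound passes to
  every subset at once.\<close>

definition dim_bound :: "bpoly set \<Rightarrow> nat \<Rightarrow> bool" where
  "dim_bound S k \<longleftrightarrow> (\<exists>T. finite T \<and> card T \<le> k \<and> S \<subseteq> bpoly.span T)"

definition lin_functional :: "(bpoly \<Rightarrow> real) \<Rightarrow> bool" where
  "lin_functional \<phi> \<longleftrightarrow> (\<forall>u v. \<phi> (u + v) = \<phi> u + \<phi> v) \<and> (\<forall>c v. \<phi> (bscale c v) = c * \<phi> v)"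

lemma lin_functional_diff: "lin_functional \<phi> \<Longrightarrow> \<phi> (u - v) = \<phi> u - \<phi> v"
  by (metis add_diff_cancel_right' diff_add_cancel lin_functional_def)

lemma lin_functional_zero: "lin_functional \<phi> \<Longrightarrow> \<phi> 0 = 0"
  using lin_functional_diff[of \<phi> 0 0] by simp

lemma subspace_kernel:
  assumes "bpoly.subspace S" "\<And>\<phi>. \<phi> \<in> \<Phi> \<Longrightarrow> lin_functional \<phi>"
  shows "bpoly.subspace {s\<in>S. \<forall>\<phi>\<in>\<Phi>. \<phi> s = 0}"
proof (rule bpoly.subspaceI)
  show "0 \<in> {s \<in> S. \<forall>\<phi>\<in>\<Phi>. \<phi> s = 0}"
    using assms by (auto simp: bpoly.subspace_0 lin_functional_zero)
  show "x + y \<in> {s \<in> S. \<forall>\<phi>\<in>\<Phi>. \<phi> s = 0}"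
    if "x \<in> {s \<in> S. \<forall>\<phi>\<in>\<Phi>. \<phi> s = 0}" "y \<in> {s \<in> S. \<forall>\<phi>\<in>\<Phi>. \<phi> s = 0}" for x y
    using that assms by (simp add: bpoly.subspace_add) (metis add_0 lin_functional_def)
  show "bscale c x \<in> {s \<in> S. \<forall>\<phi>\<in>\<Phi>. \<phi> s = 0}"
    if "x \<in> {s \<in> S. \<forall>\<phi>\<in>\<Phi>. \<phi> s = 0}" for c x
    using that assms by (simp add: bpoly.subspace_scale) (metis mult_zero_right lin_functional_def)
qed

text \<open>A kernel has codimension at most one: a single \<open>b\<close> with nonzero value
  accounts for the rest of \<open>S\<close>.\<close>

lemma dim_bound_kernelD:
  assumes S: "bpoly.subspace S" and \<phi>: "lin_functional \<phi>" and k: "dim_bound {s\<in>S. \<phi> s = 0} k"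
  shows "dim_bound S (Suc k)"
proof (cases "\<exists>b\<in>S. \<phi> b \<noteq> 0")
  case True
  then obtain b where b: "b \<in> S" "\<phi> b \<noteq> 0" by blast
  from k obtain T where T: "finite T" "card T \<le> k" "{s\<in>S. \<phi> s = 0} \<subseteq> bpoly.span T"
    unfolding dim_bound_def by blast
  have "s \<in> bpoly.span (insert b T)" if "s \<in> S" for s
  proof -
    have "s - bscale (\<phi> s / \<phi> b) b \<in> {s\<in>S. \<phi> s = 0}"
      using that b S \<phi> by (auto simp: bpoly.subspace_diff bpoly.subspace_scale lin_functional_diff)
        (simp add: lin_functional_def)
    then show ?thesis using T(3) by (auto simp: bpoly.span_breakdown_eq)
  qed
  moreover have "card (insert b T) \<le> Suc k"
    using T(1,2) by (simp add: card_insert_if)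
  ultimately show ?thesis using T(1) unfolding dim_bound_def by (meson finite_insert subsetI)
next
  case False
  then have "S = {s\<in>S. \<phi> s = 0}" by auto
  then show ?thesis using k unfolding dim_bound_def by (metis le_SucI)
qed

text \<open>Each linear condition costs at most one dimension. Read backwards, a space too large for
  the number of conditions retains solutions; conics and polynomials with prescribed double zeros
  are found in this way.\<close>

lemma dim_bound_kernelsD:
  assumes "finite \<Phi>" "bpoly.subspace S" "\<And>\<phi>. \<phi> \<in> \<Phi> \<Longrightarrow> lin_functional \<phi>"
    and "dim_bound {s\<in>S. \<forall>\<phi>\<in>\<Phi>. \<phi> s = 0} k"
  shows "dim_bound S (k + card \<Phi>)"
  using assms
proof (induction \<Phi> arbitrary: k rule: finite_induct)
  case (insert \<psi> \<Phi>)
  have eq: "{s \<in> S. \<forall>\<phi>\<in>insert \<psi> \<Phi>. \<phi> s = 0} = {s \<in> {s\<in>S. \<forall>\<phi>\<in>\<Phi>. \<phi> s = 0}. \<psi> s = 0}"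
    by auto
  have "dim_bound {s\<in>S. \<forall>\<phi>\<in>\<Phi>. \<phi> s = 0} (Suc k)"
    using insert.prems subspace_kernel[of S \<Phi>] unfolding eq
    by (intro dim_bound_kernelD[where \<phi> = \<psi>]) auto
  then have "dim_bound S (Suc k + card \<Phi>)" using insert.prems by (intro insert.IH) auto
  then show ?case using insert by simp
qed simp

text \<open>The opposite direction: \<open>v\<close> extends a basis of the kernel to a larger
  independent subset of \<open>S\<close>.\<close>

lemma dim_bound_kernelI:
  assumes \<phi>: "lin_functional \<phi>" and v: "v \<in> S" "\<phi> v \<noteq> 0" and k: "dim_bound S (Suc k)"
    and S: "bpoly.subspace S"
  shows "dim_bound {s\<in>S. \<phi> s = 0} k"
proof -
  let ?K = "{s\<in>S. \<phi> s = 0}"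
  have K: "bpoly.subspace ?K" using subspace_kernel[OF S, of "{\<phi>}"] \<phi> by simp
  obtain B where B: "B \<subseteq> ?K" "bpoly.independent B" "?K \<subseteq> bpoly.span B"
    by (rule bpoly.basis_exists[of ?K])
  have "v \<notin> bpoly.span B"
    using bpoly.span_minimal[OF B(1) K] v by auto
  then have "bpoly.independent (insert v B)" "v \<notin> B"
    using B(2) by (auto simp: bpoly.independent_insert bpoly.span_base)
  from k obtain T where T: "finite T" "card T \<le> Suc k" "S \<subseteq> bpoly.span T"
    unfolding dim_bound_def by blast
  have "finite (insert v B) \<and> card (insert v B) \<le> card T"
    using T \<open>bpoly.independent (insert v B)\<close> v B(1)
    by (intro bpoly.independent_span_bound) auto
  then have "finite B" "card B \<le> k"
    using T(2) \<open>v \<notin> B\<close> by auto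
  then show ?thesis using B(3) unfolding dim_bound_def by blast
qed

text \<open>The witnesses \<open>v\<close> are dual to the functionals up to scalars, which makes
  the conditions independent. In the induction the witness for \<open>i\<close> lies in the kernel
  of the functionals already imposed, so each condition costs a full dimension.\<close>

lemma dim_bound_separatedI:
  assumes "finite I" "bpoly.subspace S" "\<And>i. i \<in> I \<Longrightarrow> lin_functional (\<phi> i)"
    and "\<And>i. i \<in> I \<Longrightarrow> \<exists>v\<in>S. \<phi> i v \<noteq> 0 \<and> (\<forall>j\<in>I - {i}. \<phi> j v = 0)"
    and "dim_bound S (k + card I)"
  shows "dim_bound {s\<in>S. \<forall>i\<in>I. \<phi> i s = 0} k"
  using assms
proof (induction I arbitrary: k rule: finite_induct)
  case (insert i I)
  let ?S = "{s\<in>S. \<forall>i\<in>I. \<phi> i s = 0}"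
  have "dim_bound ?S (Suc k)"
  proof (rule insert.IH)
    show "\<exists>v\<in>S. \<phi> j v \<noteq> 0 \<and> (\<forall>l\<in>I - {j}. \<phi> l v = 0)" if "j \<in> I" for j
      using insert.prems(3)[of j] that by blast
  qed (use insert in auto)
  moreover obtain v where "v \<in> S" "\<phi> i v \<noteq> 0" "\<forall>j\<in>insert i I - {i}. \<phi> j v = 0"
    using insert.prems(3)[of i] by blast
  moreover have "bpoly.subspace ?S"
    using subspace_kernel[of S "\<phi> ` I"] insert.prems by auto
  ultimately have "dim_bound {s\<in>?S. \<phi> i s = 0} k"
    using insert by (intro dim_bound_kernelI[where v = v]) auto
  moreover have "{s\<in>?S. \<phi> i s = 0} = {s\<in>S. \<forall>i\<in>insert i I. \<phi> i s = 0}" by auto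
  ultimately show ?case by simp
qed simp

lemma not_dim_boundI:
  assumes "bpoly.independent B" "B \<subseteq> S" "k < card B"
  shows "\<not> dim_bound S k"
proof
  assume "dim_bound S k"
  then obtain T where "finite T" "card T \<le> k" "S \<subseteq> bpoly.span T" unfolding dim_bound_def by blast
  then have "card B \<le> card T" using bpoly.independent_span_bound[of T B] assms by auto
  with \<open>card T \<le> k\<close> assms(3) show False by simp
qed

lemma dim_bound_subset: "dim_bound S k \<Longrightarrow> T \<subseteq> S \<Longrightarrow> dim_bound T k"
  unfolding dim_bound_def by blast

section \<open>Polynomials of bounded degree and their monomial basis\<close>

definition polys_upto :: "nat \<Rightarrow> bpoly set" where
  "polys_upto d = {p. total_degree p \<le> d}"

lemma polys_upto_iff: "p \<in> polys_upto d \<longleftrightarrow> (\<forall>i j. d < i + j \<longrightarrow> coeff (coeff p j) i = 0)"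
  unfolding polys_upto_def total_degree_le_iff mem_Collect_eq by (metis not_le)

lemma coeff_bscale [simp]: "coeff (coeff (bscale c p) j) i = c * coeff (coeff p j) i"
  by (simp add: bscale_def)

lemma subspace_polys_upto: "bpoly.subspace (polys_upto d)"
  by (rule bpoly.subspaceI) (auto simp: polys_upto_iff)

lemma polys_upto_mult:
  assumes "p \<in> polys_upto d" "q \<in> polys_upto e"
  shows "p * q \<in> polys_upto (d + e)"
  unfolding polys_upto_iff
proof (intro allI impI)
  fix i j :: nat assume ij: "d + e < i + j"
  have "coeff (coeff p k) l * coeff (coeff q (j - k)) (i - l) = 0" if "k \<le> j" "l \<le> i" for k l
  proof -
    have "d < l + k \<or> e < (i - l) + (j - k)" using that ij by linarith
    then show ?thesis using assms unfolding polys_upto_iff by auto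
  qed
  then show "coeff (coeff (p * q) j) i = 0"
    by (auto simp: coeff_mult coeff_sum intro!: sum.neutral)
qed

definition bmonom :: "nat \<times> nat \<Rightarrow> bpoly" where
  "bmonom t = monom (monom 1 (fst t)) (snd t)"

lemma coeff_bmonom: "coeff (coeff (bmonom t) j) i = (if t = (i, j) then 1 else 0)"
  by (auto simp: bmonom_def coeff_monom prod_eq_iff)

lemma inj_bmonom: "inj bmonom"
  by (rule injI) (metis coeff_bmonom prod.collapse zero_neq_one)

lemma independent_bmonom: "bpoly.independent (bmonom ` T)"
proof -
  have main: "u t = 0" if "finite F" "F \<subseteq> T" "(\<Sum>v\<in>bmonom ` F. bscale (u v) v) = 0" "t \<in> bmonom ` F" for F u t
  proof -
    obtain s where s: "s \<in> F" "t = bmonom s" using \<open>t \<in> bmonom ` F\<close> by blast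
    have "(\<Sum>v\<in>F. bscale (u (bmonom v)) (bmonom v)) = 0"
      using that(3) by (subst (asm) sum.reindex) (auto intro: inj_on_subset[OF inj_bmonom])
    then have "coeff (coeff (\<Sum>v\<in>F. bscale (u (bmonom v)) (bmonom v)) (snd s)) (fst s) = 0"
      by simp
    then have "(\<Sum>v\<in>F. if v = s then u t else 0) = 0"
      unfolding coeff_sum using s(2)
      by (subst sum.cong[OF refl]) (auto simp: coeff_bmonom)
    then show ?thesis using s that(1) by simp
  qed
  then show ?thesis
    unfolding bpoly.independent_explicit_module
  proof (intro allI impI)
    fix G u v assume *: "finite G" "G \<subseteq> bmonom ` T" "(\<Sum>v\<in>G. bscale (u v) v) = 0" "v \<in> G"
    then obtain F where F: "F \<subseteq> T" "G = bmonom ` F" by (auto simp: subset_image_iff)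
    then have "finite F"
      using * finite_imageD[of bmonom F] inj_on_subset[OF inj_bmonom] by simp
    then show "u v = 0" using F * by (intro main[of F]) auto
  qed
qed

text \<open>Swapping a \<open>SIGMA\<close> over the exponent of \<open>y\<close> yields the
  cardinality directly as \<open>\<Sum>j\<le>d. Suc (d - j)\<close>, which is 6, 10 and 28 for the
  degrees 2, 3 and 6 that occur below.\<close>

definition exps_upto :: "nat \<Rightarrow> (nat \<times> nat) set" where
  "exps_upto d = prod.swap ` (SIGMA j:{..d}. {..d - j})"

lemma mem_exps_upto: "(i, j) \<in> exps_upto d \<longleftrightarrow> i + j \<le> d"
  unfolding exps_upto_def by force

lemma finite_exps_upto: "finite (exps_upto d)"
  unfolding exps_upto_def by simp

lemma card_exps_upto: "card (exps_upto d) = (\<Sum>j\<le>d. Suc (d - j))"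
  unfolding exps_upto_def by (subst card_image) (auto simp: card_SigmaI)

lemma polys_upto_eq_sum:
  assumes "p \<in> polys_upto d"
  shows "p = (\<Sum>t\<in>exps_upto d. bscale (coeff (coeff p (snd t)) (fst t)) (bmonom t))" (is "p = ?r")
proof (intro poly_eqI)
  fix j i
  have "coeff (coeff ?r j) i = (\<Sum>t\<in>exps_upto d. if t = (i, j) then coeff (coeff p j) i else 0)"
    unfolding coeff_sum by (intro sum.cong refl) (auto simp: coeff_bmonom)
  also have "\<dots> = coeff (coeff p j) i"
    using assms by (auto simp: finite_exps_upto mem_exps_upto polys_upto_iff)
  finally show "coeff (coeff p j) i = coeff (coeff ?r j) i" by simp
qed

lemma dim_bound_polys_upto: "dim_bound (polys_upto d) (\<Sum>j\<le>d. Suc (d - j))"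
  unfolding dim_bound_def
proof (intro exI conjI subsetI)
  show "card (bmonom ` exps_upto d) \<le> (\<Sum>j\<le>d. Suc (d - j))"
    unfolding card_exps_upto[symmetric] by (rule card_image_le[OF finite_exps_upto])
  fix p assume "p \<in> polys_upto d"
  then show "p \<in> bpoly.span (bmonom ` exps_upto d)"
    by (subst polys_upto_eq_sum[of p d], assumption)
      (intro bpoly.span_sum bpoly.span_scale bpoly.span_base imageI)
qed (simp add: finite_exps_upto)

lemma not_dim_bound_polys_upto: "k < (\<Sum>j\<le>d. Suc (d - j)) \<Longrightarrow> \<not> dim_bound (polys_upto d) k"
  by (rule not_dim_boundI[OF independent_bmonom, of "exps_upto d"])
    (auto simp: polys_upto_iff coeff_bmonom mem_exps_upto card_exps_upto
      card_image[OF inj_on_subset[OF inj_bmonom subset_UNIV]])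

section \<open>Evaluation in homogeneous coordinates\<close>

text \<open>
  The degree \<open>d\<close> of the homogenization is independent of \<open>total_degree p\<close>; coefficients of
  degree above \<open>d\<close> are ignored.
\<close>

definition hev :: "nat \<Rightarrow> bpoly \<Rightarrow> real \<times> real \<times> real \<Rightarrow> real" where
  "hev d p w = (\<Sum>j\<le>d. \<Sum>i\<le>d - j.
     coeff (coeff p j) i * fst w ^ i * fst (snd w) ^ j * snd (snd w) ^ (d - (i + j)))"

lemma homogenization_hev: "homogenization p x y z = hev (total_degree p) p (x, y, z)"
  by (simp add: homogenization_def hev_def)

lemma hev_add: "hev d (p + q) w = hev d p w + hev d q w"
  by (simp add: hev_def algebra_simps sum.distrib)

lemma hev_bscale: "hev d (bscale c p) w = c * hev d p w"
  by (simp add: hev_def algebra_simps sum_distrib_left)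

lemma hev_zero [simp]: "hev d 0 w = 0"
  by (simp add: hev_def)

lemma hev_sum: "hev d (\<Sum>i\<in>I. f i) w = (\<Sum>i\<in>I. hev d (f i) w)"
  by (induction I rule: infinite_finite_induct) (simp_all add: hev_add)

lemma lin_hev: "lin_functional (\<lambda>p. hev d p w)"
  by (simp add: lin_functional_def hev_add hev_bscale)

lemma continuous_hev [continuous_intros]: "continuous_on S (hev d p)"
  unfolding hev_def by (intro continuous_intros)

lemma hev_eq:
  assumes "p \<in> polys_upto d" "z \<noteq> 0"
  shows "hev d p (x, y, z) = z ^ d * beval p (x / z, y / z)"
proof -
  have "z ^ (d - (i + j)) = z ^ d / (z ^ i * z ^ j)" if "j \<le> d" "i \<le> d - j" for i j
    using that assms by (simp add: power_diff power_add)
  moreover have "total_degree p \<le> d" using assms(1) by (simp add: polys_upto_def)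
  ultimately show ?thesis
    unfolding hev_def beval_sum[OF \<open>total_degree p \<le> d\<close>] sum_distrib_left
    by (intro sum.cong refl) (simp add: power_divide)
qed

text \<open>For \<open>z \<noteq> 0\<close> this reduces to multiplicativity of
  \<open>beval\<close>; continuity in \<open>z\<close> extends it to the line at infinity, without a
  convolution of coefficients.\<close>

lemma hev_mult:
  assumes p: "p \<in> polys_upto d" and q: "q \<in> polys_upto e"
  shows "hev (d + e) (p * q) w = hev d p w * hev e q w"
proof -
  obtain x y z where w: "w = (x, y, z)" by (cases w)
  have ne: "hev (d + e) (p * q) (x, y, z) = hev d p (x, y, z) * hev e q (x, y, z)" if "z \<noteq> 0" for z
    using that hev_eq[OF polys_upto_mult[OF p q]] hev_eq[OF p] hev_eq[OF q]
    by (simp add: beval_def power_add)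
  let ?f = "\<lambda>t. hev (d + e) (p * q) (x, y, t) - hev d p (x, y, t) * hev e q (x, y, t)"
  have "isCont ?f z"
    unfolding hev_def by (intro continuous_intros) 
  then have "(?f \<longlongrightarrow> ?f z) (at z)" by (simp add: isCont_def)
  moreover have "(?f \<longlongrightarrow> 0) (at z)"
  proof (rule tendsto_eventually)
    have "eventually (\<lambda>t. t \<noteq> 0) (at z)" by (rule eventually_neq_at_within)
    then show "\<forall>\<^sub>F t in at z. ?f t = 0" by eventually_elim (simp add: ne)
  qed
  ultimately show ?thesis unfolding w using tendsto_unique[of "at z" ?f "?f z" 0] by simp
qed

definition hom :: "real \<times> real \<Rightarrow> real \<times> real \<times> real" where
  "hom a = (fst a, snd a, 1)"

lemma hev_hom: "p \<in> polys_upto d \<Longrightarrow> hev d p (hom a) = beval p a"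
  by (simp add: hom_def hev_eq)

section \<open>Conics and cubics through points in general position\<close>

text \<open>The cross product: the coefficient vector of the line through two projective points, and
  zero exactly when the two vectors are linearly dependent.\<close>

definition vprod :: "real \<times> real \<times> real \<Rightarrow> real \<times> real \<times> real \<Rightarrow> real \<times> real \<times> real" where
  "vprod = (\<lambda>(a1, a2, a3) (b1, b2, b3). (a2 * b3 - a3 * b2, a3 * b1 - a1 * b3, a1 * b2 - a2 * b1))"

definition det3 :: "real \<times> real \<times> real \<Rightarrow> real \<times> real \<times> real \<Rightarrow> real \<times> real \<times> real \<Rightarrow> real" where
  "det3 a b c = vprod a b \<bullet> c"

lemma det3_cycle: "det3 a b c = det3 b c a"
  by (cases a; cases b; cases c) (simp add: det3_def vprod_def algebra_simps)

lemma det3_swap: "det3 a b c = - det3 b a c"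
  by (cases a; cases b; cases c) (simp add: det3_def vprod_def algebra_simps)

lemma det3_refl [simp]: "det3 a a b = 0" "det3 a b a = 0" "det3 b a a = 0"
  by (cases a; cases b; simp add: det3_def vprod_def algebra_simps)+

lemma vprod_swap: "vprod a b = - vprod b a"
  by (cases a; cases b) (simp add: vprod_def)

lemma det3_eq_0I:
  assumes "n \<noteq> 0" "n \<bullet> a = 0" "n \<bullet> b = 0" "n \<bullet> c = 0"
  shows "det3 a b c = 0"
proof -
  obtain n1 n2 n3 a1 a2 a3 b1 b2 b3 c1 c2 c3 where
    v: "n = (n1, n2, n3)" "a = (a1, a2, a3)" "b = (b1, b2, b3)" "c = (c1, c2, c3)"
    by (metis prod_cases3)
  have eqs: "n1 * a1 + n2 * a2 + n3 * a3 = 0" "n1 * b1 + n2 * b2 + n3 * b3 = 0"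
    "n1 * c1 + n2 * c2 + n3 * c3 = 0"
    using assms v by (simp_all add: algebra_simps)
  have d: "det3 a b c = (a2 * b3 - a3 * b2) * c1 + (a3 * b1 - a1 * b3) * c2 + (a1 * b2 - a2 * b1) * c3"
    by (simp add: v det3_def vprod_def algebra_simps)
  \<comment> \<open>Cramer's rule: each coordinate of \<open>n\<close> times the determinant is a
    combination of the three equations.\<close>
  have "n1 * det3 a b c = 0" "n2 * det3 a b c = 0" "n3 * det3 a b c = 0"
    unfolding d using eqs by algebra+
  moreover have "n1 \<noteq> 0 \<or> n2 \<noteq> 0 \<or> n3 \<noteq> 0"
    using assms(1) v(1) by (simp add: prod_eq_iff)
  ultimately show ?thesis by auto
qed

lemma det3_eq_0_trans:
  assumes "vprod a b \<noteq> 0" "det3 a b c = 0" "det3 a b d = 0"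
  shows "det3 a c d = 0" "det3 b c d = 0"
proof -
  have n: "vprod a b \<bullet> a = 0" "vprod a b \<bullet> b = 0"
    using det3_refl(2)[of a b] det3_refl(3)[of a b] unfolding det3_def .
  show "det3 a c d = 0"
    by (rule det3_eq_0I[OF assms(1) n(1) assms(2,3)[unfolded det3_def]])
  show "det3 b c d = 0"
    by (rule det3_eq_0I[OF assms(1) n(2) assms(2,3)[unfolded det3_def]])
qed

text \<open>The line with coefficient vector \<open>n\<close> in affine coordinates;
  \<open>vprod p q\<close> as \<open>n\<close> gives the line through \<open>p\<close> and
  \<open>q\<close>.\<close>

definition linform :: "real \<times> real \<times> real \<Rightarrow> bpoly" where
  "linform n = [:[:snd (snd n), fst n:], [:fst (snd n):]:]"

lemma linform_polys_upto: "linform n \<in> polys_upto 1"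
  by (auto simp: polys_upto_iff linform_def coeff_pCons split: nat.splits)

lemma hev_linform: "hev 1 (linform n) w = n \<bullet> w"
  by (cases n; cases w) (simp add: hev_def linform_def algebra_simps)

text \<open>The first clause makes the points distinct in the projective plane, the second forbids
  four on a line; three collinear points are permitted.\<close>

definition general_position :: "(real \<times> real \<times> real) set \<Rightarrow> bool" where
  "general_position C \<longleftrightarrow> (\<forall>a\<in>C. \<forall>b\<in>C. a \<noteq> b \<longrightarrow> vprod a b \<noteq> 0) \<and>
     (\<forall>a\<in>C. \<forall>b\<in>C. \<forall>c\<in>C. \<forall>d\<in>C. distinct [a, b, c, d] \<longrightarrow> det3 a b c \<noteq> 0 \<or> det3 a b d \<noteq> 0)"

lemma general_position_subset: "general_position C \<Longrightarrow> D \<subseteq> C \<Longrightarrow> general_position D"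
  unfolding general_position_def by blast

lemma general_position_vprod:
  "general_position C \<Longrightarrow> a \<in> C \<Longrightarrow> b \<in> C \<Longrightarrow> a \<noteq> b \<Longrightarrow> vprod a b \<noteq> 0"
  unfolding general_position_def by blast

lemma general_position_det3:
  "general_position C \<Longrightarrow> {a, b, c, d} \<subseteq> C \<Longrightarrow> distinct [a, b, c, d] \<Longrightarrow>
    det3 a b c = 0 \<Longrightarrow> det3 a b d \<noteq> 0"
  unfolding general_position_def by blast

lemma card_eq_distinct_listE:
  assumes "card S = n" "0 < n"
  obtains xs where "S = set xs" "distinct xs" "length xs = n"
  using assms by (metis card_gt_0_iff distinct_card finite_distinct_list)

lemma det3_eq_0_sym: "det3 x p q = 0 \<longleftrightarrow> det3 x q p = 0"
  using det3_swap[of x p q] by (metis det3_cycle neg_equal_0_iff_equal)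

text \<open>Used with \<open>B p q\<close> saying that \<open>p, q\<close> are collinear with a fixed fifth point.\<close>

lemma matching_of_K4:
  assumes "\<And>p q. B p q \<longleftrightarrow> B q p"
    and "\<And>p q r. p \<in> S \<Longrightarrow> q \<in> S \<Longrightarrow> r \<in> S \<Longrightarrow> distinct [p, q, r] \<Longrightarrow> B p q \<Longrightarrow> \<not> B p r"
    and "a \<in> S" "b \<in> S" "c \<in> S" "d \<in> S" "distinct [a, b, c, d]"
  shows "(\<not> B a b \<and> \<not> B c d) \<or> (\<not> B a c \<and> \<not> B b d)"
proof -
  have "B a b \<Longrightarrow> \<not> B a c" "B b a \<Longrightarrow> \<not> B b d" "B c d \<Longrightarrow> \<not> B c a" "B d c \<Longrightarrow> \<not> B d b"
    using assms(2)[of a b c] assms(2)[of b a d] assms(2)[of c d a] assms(2)[of d c b] assms(3-7)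
    by auto
  then show ?thesis using assms(1) by blast
qed

text \<open>Two points collinear with \<open>x\<close> and \<open>p\<close> would put four points on
  a line. So the pairs collinear with \<open>x\<close> form a matching, as
  \<open>matching_of_K4\<close> demands.\<close>

lemma det3_eq_0_matching:
  assumes "general_position C" "x \<in> C" "p \<in> C - {x}" "q \<in> C - {x}" "r \<in> C - {x}"
    "distinct [p, q, r]" "det3 x p q = 0"
  shows "det3 x p r \<noteq> 0"
  using general_position_det3[of C x p q r] assms by auto

lemma hev_linform2:
  "linform m * linform n \<in> polys_upto 2" "hev 2 (linform m * linform n) w = (m \<bullet> w) * (n \<bullet> w)"
  using polys_upto_mult[OF linform_polys_upto linform_polys_upto, of m n]
    hev_mult[OF linform_polys_upto linform_polys_upto, of m n w]
  by (simp_all add: hev_linform[unfolded One_nat_def] numeral_2_eq_2)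

lemma hev_linform_mult:
  assumes "f \<in> polys_upto 2"
  shows "linform m * f \<in> polys_upto 3" "hev 3 (linform m * f) w = (m \<bullet> w) * hev 2 f w"
  using polys_upto_mult[OF linform_polys_upto assms, of m]
    hev_mult[OF linform_polys_upto assms, of m w]
  by (simp_all add: hev_linform[unfolded One_nat_def] numeral_3_eq_3)

text \<open>A pair of lines covers the four other points. Of two disjoint pairings of these points,
  one has both lines off \<open>x\<close>.\<close>

lemma conic_separating:
  assumes C: "general_position C" "card C = 5" and x: "x \<in> C"
  shows "\<exists>f\<in>polys_upto 2. hev 2 f x \<noteq> 0 \<and> (\<forall>y\<in>C - {x}. hev 2 f y = 0)"
proof -
  have "card (C - {x}) = 4" using C x by (simp add: card_Diff_singleton)
  then obtain xs where xs: "C - {x} = set xs" "distinct xs" "length xs = 4"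
    by (rule card_eq_distinct_listE) simp
  then obtain a b c d where abcd: "xs = [a, b, c, d]"
    by (auto simp: length_Suc_conv numeral_eq_Suc)
  define f where "f p q r s = linform (vprod p q) * linform (vprod r s)" for p q r s
  have f: "f p q r s \<in> polys_upto 2" "hev 2 (f p q r s) y = det3 p q y * det3 r s y" for p q r s y
    using hev_linform2 by (simp_all add: f_def det3_def)
  have "(det3 x a b \<noteq> 0 \<and> det3 x c d \<noteq> 0) \<or> (det3 x a c \<noteq> 0 \<and> det3 x b d \<noteq> 0)"
    using xs abcd
    by (intro matching_of_K4[where S = "C - {x}", OF det3_eq_0_sym det3_eq_0_matching[OF C(1) x]]) auto
  then have "hev 2 (f a b c d) x \<noteq> 0 \<or> hev 2 (f a c b d) x \<noteq> 0"
    unfolding f det3_cycle[of x, symmetric] by simp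
  then show ?thesis unfolding xs(1) abcd
    by (elim disjE; intro bexI[OF _ f(1)] conjI) (auto simp: f)
qed

text \<open>Three lines cover the six other points: \<open>a\<close> is first joined to whichever of
  \<open>b\<close>, \<open>c\<close> keeps the line off \<open>x\<close>, and the remaining four
  points are paired as for conics.\<close>

lemma cubic_separating:
  assumes C: "general_position C" "card C = 7" and x: "x \<in> C"
  shows "\<exists>f\<in>polys_upto 3. hev 3 f x \<noteq> 0 \<and> (\<forall>y\<in>C - {x}. hev 3 f y = 0)"
proof -
  have "card (C - {x}) = 6" using C x by (simp add: card_Diff_singleton)
  then obtain xs where xs: "C - {x} = set xs" "distinct xs" "length xs = 6"
    by (rule card_eq_distinct_listE) simp
  then obtain a b c d e g where abc: "xs = [a, b, c, d, e, g]"
    by (auto simp: length_Suc_conv numeral_eq_Suc)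
  define f where "f p q r s t u = linform (vprod p q) * (linform (vprod r s) * linform (vprod t u))"
    for p q r s t u
  have f: "f p q r s t u \<in> polys_upto 3"
    "hev 3 (f p q r s t u) y = det3 p q y * (det3 r s y * det3 t u y)" for p q r s t u y
    using hev_linform_mult hev_linform2 by (simp_all add: f_def det3_def)
  note M = matching_of_K4[where S = "C - {x}", OF det3_eq_0_sym det3_eq_0_matching[OF C(1) x]]
  have "det3 x a b \<noteq> 0 \<or> det3 x a c \<noteq> 0"
    using det3_eq_0_matching[OF C(1) x, of a b c] xs abc by auto
  moreover have "(det3 x c d \<noteq> 0 \<and> det3 x e g \<noteq> 0) \<or> (det3 x c e \<noteq> 0 \<and> det3 x d g \<noteq> 0)"
    using xs abc by (intro M) auto
  moreover have "(det3 x b d \<noteq> 0 \<and> det3 x e g \<noteq> 0) \<or> (det3 x b e \<noteq> 0 \<and> det3 x d g \<noteq> 0)"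
    using xs abc by (intro M) auto
  ultimately have "hev 3 (f a b c d e g) x \<noteq> 0 \<or> hev 3 (f a b c e d g) x \<noteq> 0 \<or>
      hev 3 (f a c b d e g) x \<noteq> 0 \<or> hev 3 (f a c b e d g) x \<noteq> 0"
    unfolding f det3_cycle[of x, symmetric] by auto
  then show ?thesis unfolding xs(1) abc
    by (elim disjE; intro bexI[OF _ f(1)] conjI) (auto simp: f)
qed

text \<open>Five independent conditions on a space of dimension 6; the analogue for cubics is 10 - 7
  = 3.\<close>

lemma dim_bound_conics:
  assumes "general_position C" "card C = 5"
  shows "dim_bound {f\<in>polys_upto 2. \<forall>x\<in>C. hev 2 f x = 0} 1"
proof (rule dim_bound_separatedI)
  show "finite C" using assms(2) by (simp add: card_ge_0_finite)
  show "dim_bound (polys_upto 2) (1 + card C)"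
    using dim_bound_polys_upto[of 2] assms(2) by (simp add: numeral_eq_Suc)
qed (use conic_separating[OF assms] in \<open>auto intro: subspace_polys_upto lin_hev\<close>)

lemma dim_bound_cubics:
  assumes "general_position C" "card C = 7"
  shows "dim_bound {f\<in>polys_upto 3. \<forall>x\<in>C. hev 3 f x = 0} 3"
proof (rule dim_bound_separatedI)
  show "finite C" using assms(2) by (simp add: card_ge_0_finite)
  show "dim_bound (polys_upto 3) (3 + card C)"
    using dim_bound_polys_upto[of 3] assms(2) by (simp add: numeral_eq_Suc)
qed (use cubic_separating[OF assms] in \<open>auto intro: subspace_polys_upto lin_hev\<close>)

lemma conic_exists:
  assumes "finite C" "card C \<le> 5"
  shows "\<exists>f\<in>polys_upto 2. f \<noteq> 0 \<and> (\<forall>x\<in>C. hev 2 f x = 0)"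
proof (rule ccontr)
  assume none: "\<not> ?thesis"
  let ?\<Phi> = "(\<lambda>x f. hev 2 f x) ` C"
  have "f \<in> bpoly.span {}" if "f \<in> polys_upto 2" "\<forall>x\<in>C. hev 2 f x = 0" for f
    using none that by (cases "f = 0") (auto simp: bpoly.span_zero)
  then have "{f\<in>polys_upto 2. \<forall>x\<in>C. hev 2 f x = 0} \<subseteq> bpoly.span {}" by blast
  then have "dim_bound {f\<in>polys_upto 2. \<forall>x\<in>C. hev 2 f x = 0} 0"
    unfolding dim_bound_def by (intro exI[of _ "{}"]) simp
  then have "dim_bound {f\<in>polys_upto 2. \<forall>\<phi>\<in>?\<Phi>. \<phi> f = 0} 0" by simp
  then have "dim_bound (polys_upto 2) (0 + card ?\<Phi>)"
    by (rule dim_bound_kernelsD[OF finite_imageI[OF assms(1)] subspace_polys_upto, rotated])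
      (auto intro: lin_hev)
  moreover have "card ?\<Phi> \<le> 5"
    using card_image_le[OF assms(1)] assms(2) by (rule order_trans)
  moreover have "(\<Sum>j\<le>2. Suc (2 - j)) = 6" by (simp add: numeral_eq_Suc)
  ultimately show False using not_dim_bound_polys_upto[of "0 + card ?\<Phi>" 2] by linarith
qed

text \<open>By \<open>dim_bound_conics\<close> both \<open>f\<close> and \<open>g\<close> are
  multiples of one polynomial, so zeros of \<open>f\<close> are zeros of \<open>g\<close>.\<close>

lemma conic_unique:
  assumes C: "general_position C" "card C = 5"
    and f: "f \<in> polys_upto 2" "f \<noteq> 0" "\<forall>x\<in>C. hev 2 f x = 0"
    and g: "g \<in> polys_upto 2" "g \<noteq> 0" "\<forall>x\<in>C. hev 2 g x = 0"
    and w: "hev 2 f w = 0"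
  shows "hev 2 g w = 0"
proof -
  obtain T where T: "finite T" "card T \<le> 1" "{f\<in>polys_upto 2. \<forall>x\<in>C. hev 2 f x = 0} \<subseteq> bpoly.span T"
    using dim_bound_conics[OF C] unfolding dim_bound_def by blast
  have "f \<in> bpoly.span T" "g \<in> bpoly.span T" using T(3) f g by auto
  moreover have "T \<noteq> {}" using \<open>f \<in> bpoly.span T\<close> f(2) by auto
  then obtain t where "T = {t}" using T(1,2) by (metis card_0_eq card_1_singletonE le_neq_implies_less less_one)
  ultimately obtain k l where "f = bscale k t" "g = bscale l t"
    by (auto simp: bpoly.span_singleton)
  then show ?thesis using w f(2) by (auto simp: hev_bscale)
qed

section \<open>Cubics avoiding an eighth point\<close>

text \<open>The two conics share the five points of \<open>P - {p, p'}\<close> and are therefore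
  proportional, while \<open>g\<close> vanishes at \<open>p\<close>.\<close>

lemma conic_vanishing_everywhere:
  assumes "p \<in> P" "p' \<in> P" "p \<noteq> p'" "general_position P" "card P = 7"
    and f: "f \<in> polys_upto 2" "f \<noteq> 0" "\<forall>x\<in>P - {p}. hev 2 f x = 0"
    and g: "g \<in> polys_upto 2" "g \<noteq> 0" "\<forall>x\<in>P - {p'}. hev 2 g x = 0"
  shows "\<forall>x\<in>P. hev 2 f x = 0"
proof -
  have "general_position (P - {p, p'})"
    using assms(4) by (rule general_position_subset) auto
  moreover have "card (P - {p, p'}) = 5"
    using assms by (subst card_Diff_subset) auto
  ultimately have "hev 2 f p = 0"
    by (rule conic_unique[OF _ _ g(1,2) _ f(1,2)]) (use f(3) g(3) assms(1,3) in blast)+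
  then show ?thesis using f(3) by blast
qed

context
  fixes P :: "(real \<times> real \<times> real) set" and w :: "real \<times> real \<times> real"
  assumes P: "general_position P" "card P = 7"
    and w: "\<And>p. p \<in> P \<Longrightarrow> vprod w p \<noteq> 0"
begin

lemma det3_pencil:
  assumes "{a, b, c} \<subseteq> P" "det3 w a b = 0" "det3 w a c = 0"
  shows "det3 a b c = 0" "det3 w b c = 0"
  using det3_eq_0_trans[OF w, of a b c] assms by auto

text \<open>A line through \<open>w\<close> contains at most three points of \<open>P\<close>, as
  four of them would be collinear.\<close>

lemma det3_pencil_card:
  assumes "{a, b, c, d} \<subseteq> P" "distinct [a, b, c, d]" "det3 w a b = 0" "det3 w a c = 0"
  shows "det3 w a d \<noteq> 0"
  using general_position_det3[OF P(1) assms(1,2)] det3_pencil(1)[of a b c] det3_pencil(1)[of a b d] assms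
  by auto

text \<open>Only lines through \<open>w\<close> can violate general position, and \<open>tri\<close>
  allows at most two points of \<open>D\<close> on each. If \<open>w\<close> is among the last two
  points, the collinearity is first rewritten as one of a line through \<open>w\<close>.\<close>

lemma general_position_insert:
  assumes D: "D \<subseteq> P"
    and tri: "\<And>a b c. {a, b, c} \<subseteq> D \<Longrightarrow> distinct [a, b, c] \<Longrightarrow> det3 w a b = 0 \<Longrightarrow> det3 w a c \<noteq> 0"
  shows "general_position (insert w D)"
  unfolding general_position_def
proof (intro conjI ballI impI)
  fix a b assume "a \<in> insert w D" "b \<in> insert w D" "a \<noteq> b"
  then show "vprod a b \<noteq> 0"
    using w[of b] w[of a] D general_position_vprod[OF P(1), of a b] vprod_swap[of a w]
    by (metis (no_types) insert_iff neg_equal_0_iff_equal subsetD)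
next
  fix a b c d assume mem: "a \<in> insert w D" "b \<in> insert w D" "c \<in> insert w D" "d \<in> insert w D"
    and dist: "distinct [a, b, c, d]"
  show "det3 a b c \<noteq> 0 \<or> det3 a b d \<noteq> 0"
  proof (rule ccontr)
    assume "\<not> ?thesis"
    then have z: "det3 a b c = 0" "det3 a b d = 0" by auto
    consider "a = w" "{b, c, d} \<subseteq> D" | "b = w" "{a, c, d} \<subseteq> D" | "c = w" "{a, b, d} \<subseteq> D"
      | "d = w" "{a, b, c} \<subseteq> D" | "{a, b, c, d} \<subseteq> D"
      using mem dist by auto
    then show False
    proof cases
      case 1 then show False using tri[of b c d] z dist by auto
    next
      case 2 then show False using tri[of a c d] z dist det3_swap[of a w] by auto
    next
      case 3
      then have "vprod a b \<noteq> 0" using D dist by (intro general_position_vprod[OF P(1)]) auto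
      then have "det3 a c d = 0" using z by (rule det3_eq_0_trans)
      moreover have "det3 w a b = 0" using z(1) 3 det3_cycle[of w a b] by simp
      ultimately show False using 3 tri[of a b d] dist det3_swap[of a w d] by auto
    next
      case 4
      then have "vprod a b \<noteq> 0" using D dist by (intro general_position_vprod[OF P(1)]) auto
      then have "det3 a d c = 0" using z(2,1) by (rule det3_eq_0_trans)
      moreover have "det3 w a b = 0" using z(2) 4 det3_cycle[of w a b] by simp
      ultimately show False using 4 tri[of a b c] dist det3_swap[of a w c] by auto
    next
      case 5 then show False
        using general_position_det3[OF P(1), of a b c d] z dist D by auto
    qed
  qed
qed

context
  assumes cubics: "\<And>f. f \<in> polys_upto 3 \<Longrightarrow> \<forall>p\<in>P. hev 3 f p = 0 \<Longrightarrow> hev 3 f w = 0"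
begin

lemma conic_complement:
  assumes "p \<in> P" "q \<in> P" "p \<noteq> q" "det3 w p q \<noteq> 0"
  obtains f where "f \<in> polys_upto 2" "f \<noteq> 0" "\<forall>x\<in>insert w (P - {p, q}). hev 2 f x = 0"
proof -
  have "finite P" using P(2) by (simp add: card_ge_0_finite)
  moreover have "card (P - {p, q}) \<le> 5"
    using assms P(2) by (subst card_Diff_subset) auto
  ultimately obtain f where f: "f \<in> polys_upto 2" "f \<noteq> 0" "\<forall>x\<in>P - {p, q}. hev 2 f x = 0"
    using conic_exists[of "P - {p, q}"] by auto
  have "hev 3 (linform (vprod p q) * f) x = 0" if "x \<in> P" for x
    using f that by (cases "x = p"; cases "x = q") (auto simp: hev_linform_mult simp flip: det3_def)
  then have "hev 3 (linform (vprod p q) * f) w = 0"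
    using cubics hev_linform_mult(1)[OF f(1)] by blast
  then have "hev 2 f w = 0"
    using assms(4) det3_cycle[of w p q] by (auto simp: hev_linform_mult[OF f(1)] simp flip: det3_def)
  then show thesis using f that by auto
qed

text \<open>The conics for \<open>{p, q}\<close> and \<open>{p, r}\<close> share \<open>w\<close>
  and the four points of \<open>P - {p, q, r}\<close>, which are in general position by
  \<open>tri\<close>. Hence they are proportional, and the second one passes through
  \<open>q\<close>.\<close>

lemma conic_omitting:
  assumes "{p, q, r} \<subseteq> P" "distinct [p, q, r]" "det3 w p q \<noteq> 0" "det3 w p r \<noteq> 0"
    and tri: "\<And>a b c. {a, b, c} \<subseteq> P - {p, q, r} \<Longrightarrow> distinct [a, b, c] \<Longrightarrow> det3 w a b = 0 \<Longrightarrow> det3 w a c \<noteq> 0"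
  obtains f where "f \<in> polys_upto 2" "f \<noteq> 0" "\<forall>x\<in>P - {p}. hev 2 f x = 0"
proof -
  obtain f where f: "f \<in> polys_upto 2" "f \<noteq> 0" "\<forall>x\<in>insert w (P - {p, q}). hev 2 f x = 0"
    using assms by (auto intro: conic_complement[of p q])
  obtain g where g: "g \<in> polys_upto 2" "g \<noteq> 0" "\<forall>x\<in>insert w (P - {p, r}). hev 2 g x = 0"
    using assms by (auto intro: conic_complement[of p r])
  have gp: "general_position (insert w (P - {p, q, r}))"
    by (rule general_position_insert[OF Diff_subset tri])
  have "w \<notin> P" using w[of w] by (auto simp: vprod_def case_prod_unfold zero_prod_def)
  moreover have "finite P" using P(2) by (simp add: card_ge_0_finite)
  moreover have "card (P - {p, q, r}) = 4"
    using assms P(2) by (subst card_Diff_subset) auto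
  ultimately have card: "card (insert w (P - {p, q, r})) = 5" by simp
  have "hev 2 f q = 0"
    using assms(1,2) f(3) g(3) by (intro conic_unique[OF gp card g(1,2) _ f(1,2)]) auto
  then show thesis using f that[of f] by blast
qed

lemma conic_through_all:
  obtains f where "f \<in> polys_upto 2" "f \<noteq> 0" "\<forall>x\<in>P. hev 2 f x = 0"
proof -
  define E where "E s \<longleftrightarrow> (\<exists>f. f \<in> polys_upto 2 \<and> f \<noteq> 0 \<and> (\<forall>x\<in>P - {s}. hev 2 f x = 0))" for s
  have EI: "E s" if "{s, q, r} \<subseteq> P" "distinct [s, q, r]" "det3 w s q \<noteq> 0" "det3 w s r \<noteq> 0"
    "\<And>a b c. {a, b, c} \<subseteq> P - {s, q, r} \<Longrightarrow> distinct [a, b, c] \<Longrightarrow> det3 w a b = 0 \<Longrightarrow> det3 w a c \<noteq> 0"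
    for s q r
    using conic_omitting[OF that(1-4)] that(5) unfolding E_def by metis
  have "\<exists>p\<in>P. \<exists>p'\<in>P. p \<noteq> p' \<and> E p \<and> E p'"
  \<comment> \<open>The split is whether some line through \<open>w\<close> contains three points of
    \<open>P\<close>; such a line obstructs the hypothesis \<open>tri\<close> of
    \<open>conic_omitting\<close> unless one of its points is removed.\<close>
  proof (cases "\<exists>a b c. {a, b, c} \<subseteq> P \<and> distinct [a, b, c] \<and> det3 w a b = 0 \<and> det3 w a c = 0")
    case True
    then obtain a b c where abc: "{a, b, c} \<subseteq> P" "distinct [a, b, c]" "det3 w a b = 0" "det3 w a c = 0"
      by blast
    have bc: "det3 w b c = 0" using det3_pencil(2)[OF abc(1,3,4)] .
    have "card (P - {a, b, c}) = 4"
      using abc P(2) by (subst card_Diff_subset) auto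
    then obtain xs where xs: "P - {a, b, c} = set xs" "distinct xs" "length xs = 4"
      by (rule card_eq_distinct_listE) simp
    then obtain d e f g where defg: "xs = [d, e, f, g]"
      by (auto simp: length_Suc_conv numeral_eq_Suc)
    have D: "P - {a, b, c} = {d, e, f, g}" using xs(1) defg by simp
    have dist: "distinct [a, b, c, d, e, f, g]" using D xs(2) abc(2) unfolding defg by auto
    have Peq: "P = {a, b, c, d, e, f, g}" using D abc(1) by blast
    \<comment> \<open>The line through \<open>w\<close> and one of \<open>a\<close>,
      \<open>b\<close>, \<open>c\<close> contains all three and hence none of the other four
      points.\<close>
    have sep: "det3 w s x \<noteq> 0" "det3 w x s \<noteq> 0" if s: "s \<in> {a, b, c}" and x: "x \<in> {d, e, f, g}" for s x
    proof -
      have "det3 w a x \<noteq> 0" "det3 w b x \<noteq> 0" "det3 w c x \<noteq> 0"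
        using det3_pencil_card[of a b c x] det3_pencil_card[of b a c x] det3_pencil_card[of c a b x]
          abc bc x dist det3_eq_0_sym[of w] unfolding Peq by auto
      then show "det3 w s x \<noteq> 0" "det3 w x s \<noteq> 0"
        using s det3_eq_0_sym[of w] by auto
    qed
    \<comment> \<open>After removal of \<open>s\<close>, \<open>d\<close>, \<open>e\<close> there
      remain two points of the special line and \<open>f\<close>, \<open>g\<close>. A line through
      \<open>w\<close> with three of these would join a point of the special line to
      \<open>f\<close> or \<open>g\<close>, against \<open>sep\<close>.\<close>
    have "E s" if s: "s \<in> {a, b}" for s
    proof (rule EI[of s d e])
      fix x y z assume xyz: "{x, y, z} \<subseteq> P - {s, d, e}" "distinct [x, y, z]" "det3 w x y = 0"
      have mem: "x \<in> {a, b, c} - {s} \<union> {f, g}" "y \<in> {a, b, c} - {s} \<union> {f, g}" "z \<in> {a, b, c} - {s} \<union> {f, g}"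
        using xyz(1) Peq by auto
      then show "det3 w x z \<noteq> 0"
      proof (cases "x \<in> {a, b, c}")
        case True
        then have "y \<in> {f, g} \<or> z \<in> {f, g}"
          using mem xyz(2) s dist by auto
        then show ?thesis using sep(1)[OF True] xyz(3) by blast
      next
        case False
        then have x: "x \<in> {d, e, f, g}" using mem by auto
        have "y \<in> {a, b, c} \<or> z \<in> {a, b, c}"
          using mem xyz(2) False by auto
        then show ?thesis using sep(2)[OF _ x] xyz(3) by blast
      qed
    qed (use s dist Peq in \<open>auto simp: sep\<close>)
    then have "E a" "E b" by blast+
    then show ?thesis using abc(1,2) by auto
  next
    case False
    have EI': "E s" if "{s, q, r} \<subseteq> P" "distinct [s, q, r]" "det3 w s q \<noteq> 0" "det3 w s r \<noteq> 0" for s q r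
      using that by (rule EI) (use False in blast)
    have main: "E s" if "s \<in> P" for s
    proof -
      have "card (P - {s}) = 6" using P(2) that by (simp add: card_Diff_singleton)
      then obtain xs where xs: "P - {s} = set xs" "distinct xs" "length xs = 6"
        by (rule card_eq_distinct_listE) simp
      then obtain a b c d e f where "xs = [a, b, c, d, e, f]"
        by (auto simp: length_Suc_conv numeral_eq_Suc)
      then have abc: "distinct [s, a, b, c]" "{s, a, b, c} \<subseteq> P" using xs that by auto
      \<comment> \<open>At most one of \<open>a\<close>, \<open>b\<close>, \<open>c\<close> is
        collinear with \<open>w\<close> and \<open>s\<close>, so two of them serve as
        \<open>q\<close> and \<open>r\<close>.\<close>
      then have "\<not> (det3 w s a = 0 \<and> det3 w s b = 0)" "\<not> (det3 w s a = 0 \<and> det3 w s c = 0)"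
        "\<not> (det3 w s b = 0 \<and> det3 w s c = 0)"
        using False by (metis distinct_length_2_or_more insert_subset)+
      then consider "det3 w s a \<noteq> 0" "det3 w s b \<noteq> 0" | "det3 w s a \<noteq> 0" "det3 w s c \<noteq> 0"
        | "det3 w s b \<noteq> 0" "det3 w s c \<noteq> 0" by blast
      then show ?thesis
        by cases (use abc EI'[of s a b] EI'[of s a c] EI'[of s b c] in simp_all)
    qed
    have "P \<noteq> {}" using P(2) by auto
    then obtain p where p: "p \<in> P" by blast
    have "card (P - {p}) = 6" using P(2) p by (simp add: card_Diff_singleton)
    then have "P - {p} \<noteq> {}" by (metis card.empty zero_neq_numeral)
    then obtain p' where "p' \<in> P" "p \<noteq> p'" by blast
    then show ?thesis using p main by blast
  qed
  then obtain p p' where pp: "p \<in> P" "p' \<in> P" "p \<noteq> p'" "E p" "E p'" by blast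
  from pp(4,5) obtain f g where f: "f \<in> polys_upto 2" "f \<noteq> 0" "\<forall>x\<in>P - {p}. hev 2 f x = 0"
    and g: "g \<in> polys_upto 2" "g \<noteq> 0" "\<forall>x\<in>P - {p'}. hev 2 g x = 0"
    unfolding E_def by metis
  show thesis
    using conic_vanishing_everywhere[OF pp(1-3) P f g] f(1,2) that by blast
qed

end

end

lemma cubic_avoiding:
  assumes "general_position P" "card P = 7" "\<And>p. p \<in> P \<Longrightarrow> vprod w p \<noteq> 0"
    and "\<And>f. f \<in> polys_upto 2 \<Longrightarrow> \<forall>x\<in>P. hev 2 f x = 0 \<Longrightarrow> f = 0"
  shows "\<exists>f\<in>polys_upto 3. (\<forall>p\<in>P. hev 3 f p = 0) \<and> hev 3 f w \<noteq> 0"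
proof (rule ccontr)
  assume "\<not> ?thesis"
  then have cubics: "hev 3 f w = 0" if "f \<in> polys_upto 3" "\<forall>p\<in>P. hev 3 f p = 0" for f
    using that by blast
  obtain f where "f \<in> polys_upto 2" "f \<noteq> 0" "\<forall>x\<in>P. hev 2 f x = 0"
    by (rule conic_through_all[OF assms(1-3) cubics])
  then show False using assms(4) by blast
qed

section \<open>Gradients and second order approximation\<close>

lemma beval_add [simp]: "beval (p + q) a = beval p a + beval q a"
  by (simp add: beval_def)

lemma beval_mult [simp]: "beval (p * q) a = beval p a * beval q a"
  by (simp add: beval_def)

lemma beval_power [simp]: "beval (p ^ n) a = beval p a ^ n"
  by (simp add: beval_def)

lemma beval_sum_fun [simp]: "beval (\<Sum>i\<in>I. f i) a = (\<Sum>i\<in>I. beval (f i) a)"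
  by (induction I rule: infinite_finite_induct) (simp_all, simp_all add: beval_def)

lemma beval_bscale [simp]: "beval (bscale c p) a = c * beval p a"
  by (simp add: beval_def bscale_def)

lemma beval_pCons: "beval (pCons c p) a = poly c (fst a) + snd a * beval p a"
  by (simp add: beval_def)

lemma partial_x_add: "partial_x (p + q) = partial_x p + partial_x q"
  by (rule poly_eqI) (simp add: partial_x_def coeff_map_poly pderiv_add)

lemma partial_x_bscale: "partial_x (bscale c p) = bscale c (partial_x p)"
  by (rule poly_eqI) (simp add: partial_x_def coeff_map_poly bscale_def pderiv_smult)

lemma pderiv_sum: "pderiv (\<Sum>i\<in>I. f i) = (\<Sum>i\<in>I. pderiv (f i))"
  by (induction I rule: infinite_finite_induct) (simp_all add: pderiv_add)

lemma partial_x_mult: "partial_x (p * q) = p * partial_x q + q * partial_x p"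
proof (rule poly_eqI)
  fix n
  have "pderiv (\<Sum>i\<le>n. coeff p i * coeff q (n - i)) =
      (\<Sum>i\<le>n. coeff p i * pderiv (coeff q (n - i))) + (\<Sum>i\<le>n. pderiv (coeff p i) * coeff q (n - i))"
    by (simp add: pderiv_sum pderiv_mult sum.distrib algebra_simps)
  then show "coeff (partial_x (p * q)) n = coeff (p * partial_x q + q * partial_x p) n"
    by (subst mult.commute[of q]) (simp add: partial_x_def coeff_map_poly coeff_mult)
qed

lemma partial_x_pCons: "partial_x (pCons c p) = pCons (pderiv c) (partial_x p)"
  by (rule poly_eqI) (simp add: partial_x_def coeff_map_poly coeff_pCons split: nat.splits)

lemma grad_add: "grad (p + q) a = grad p a + grad q a"
  by (simp add: grad_def partial_x_add partial_y_def pderiv_add)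

lemma grad_bscale: "grad (bscale c p) a = c *\<^sub>R grad p a"
  by (simp add: grad_def partial_x_bscale partial_y_def) (simp add: bscale_def pderiv_smult beval_def pderiv_pCons)

lemma grad_mult: "grad (p * q) a = beval p a *\<^sub>R grad q a + beval q a *\<^sub>R grad p a"
  by (simp add: grad_def partial_x_mult partial_y_def pderiv_mult)

lemma lin_functionals:
  "lin_functional (\<lambda>p. beval p a)" "lin_functional (\<lambda>p. beval (partial_x p) a)"
  "lin_functional (\<lambda>p. beval (partial_y p) a)"
  using grad_add[of _ _ a] grad_bscale[of _ _ a] by (simp_all add: lin_functional_def grad_def)

lemma grad_linform: "grad (linform n) a = (fst n, fst (snd n))"
  by (simp add: grad_def linform_def partial_x_pCons partial_y_def beval_pCons pderiv_pCons)
    (simp add: partial_x_def beval_def)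

lemma poly_taylor2:
  fixes p :: "real poly"
  shows "\<exists>s. \<forall>x. poly p x = poly p a + poly (pderiv p) a * (x - a) + (x - a)\<^sup>2 * poly s x"
proof (induction p)
  case (pCons c p)
  then obtain s where s: "\<And>x. poly p x = poly p a + poly (pderiv p) a * (x - a) + (x - a)\<^sup>2 * poly s x"
    by blast
  have "poly (pCons c p) x = poly (pCons c p) a + poly (pderiv (pCons c p)) a * (x - a) +
      (x - a)\<^sup>2 * poly ([:poly (pderiv p) a:] + pCons 0 s) x" for x
  proof -
    have "x * poly p x = x * (poly p a + poly (pderiv p) a * (x - a) + (x - a)\<^sup>2 * poly s x)"
      by (simp flip: s)
    then show ?thesis
      by (simp add: pderiv_pCons algebra_simps power2_eq_square)
  qed
  then show ?case by blast
qed (auto intro: exI[of _ 0])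

text \<open>Induction on the degree in \<open>y\<close>. In the new term the factor
  \<open>snd x\<close> is split at \<open>snd a\<close>, which moves the quadratic terms arising
  from the gradient into \<open>s\<close> and \<open>t\<close>. Only continuity of the coefficients
  is recorded, as it bounds them near \<open>a\<close>.\<close>

lemma beval_taylor2:
  "\<exists>r s t. continuous_on UNIV r \<and> continuous_on UNIV s \<and> continuous_on UNIV t \<and>
     (\<forall>x. beval p x = beval p a + grad p a \<bullet> (x - a) + (fst x - fst a)\<^sup>2 * r x +
        (fst x - fst a) * (snd x - snd a) * s x + (snd x - snd a)\<^sup>2 * t x)"
proof (induction p)
  case 0
  show ?case
    by (intro exI[of _ "\<lambda>_. 0"]) (simp add: beval_def grad_def partial_x_def partial_y_def inner_prod_def)
next
  case (pCons c p)
  then obtain r s t where cont: "continuous_on UNIV r" "continuous_on UNIV s" "continuous_on UNIV t"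
    and p: "\<And>x. beval p x = beval p a + grad p a \<bullet> (x - a) + (fst x - fst a)\<^sup>2 * r x +
        (fst x - fst a) * (snd x - snd a) * s x + (snd x - snd a)\<^sup>2 * t x" by blast
  obtain u where u: "\<And>x. poly c x = poly c (fst a) + poly (pderiv c) (fst a) * (x - fst a) + (x - fst a)\<^sup>2 * poly u x"
    using poly_taylor2[of c "fst a"] by blast
  have g: "grad (pCons c p) a = (poly (pderiv c) (fst a) + snd a * fst (grad p a), beval p a + snd a * snd (grad p a))"
    by (simp add: grad_def partial_x_pCons partial_y_def pderiv_pCons beval_pCons)
  have "beval (pCons c p) x = beval (pCons c p) a + grad (pCons c p) a \<bullet> (x - a) +
      (fst x - fst a)\<^sup>2 * (poly u (fst x) + snd x * r x) +
      (fst x - fst a) * (snd x - snd a) * (fst (grad p a) + snd x * s x) +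
      (snd x - snd a)\<^sup>2 * (snd (grad p a) + snd x * t x)" for x
    unfolding beval_pCons g p[of x] u[of "fst x"]
    by (simp add: inner_prod_def algebra_simps power2_eq_square)
  moreover have "continuous_on UNIV (\<lambda>x. poly u (fst x) + snd x * r x)"
    "continuous_on UNIV (\<lambda>x. fst (grad p a) + snd x * s x)"
    "continuous_on UNIV (\<lambda>x. snd (grad p a) + snd x * t x)"
    by (intro continuous_intros cont)+
  ultimately show ?case by blast
qed

lemma beval_linear_approx:
  "\<exists>M>0. \<forall>\<^sub>F x in nhds a. \<bar>beval p x - beval p a - grad p a \<bullet> (x - a)\<bar> \<le> M * (norm (x - a))\<^sup>2"
proof -
  obtain r s t where cont: "continuous_on UNIV r" "continuous_on UNIV s" "continuous_on UNIV t"
    and p: "\<And>x. beval p x = beval p a + grad p a \<bullet> (x - a) + (fst x - fst a)\<^sup>2 * r x +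
        (fst x - fst a) * (snd x - snd a) * s x + (snd x - snd a)\<^sup>2 * t x"
    using beval_taylor2[of p a] by blast
  have bd: "\<forall>\<^sub>F x in nhds a. \<bar>f x\<bar> < \<bar>f a\<bar> + 1" if "continuous_on UNIV f" for f :: "real \<times> real \<Rightarrow> real"
  proof -
    have "isCont f a" using that continuous_on_eq_continuous_at[OF open_UNIV] by blast
    then have "(f \<longlongrightarrow> f a) (nhds a)" by (simp add: tendsto_nhds_iff isCont_def)
    then have "((\<lambda>x. \<bar>f x\<bar>) \<longlongrightarrow> \<bar>f a\<bar>) (nhds a)" by (rule tendsto_rabs)
    then show ?thesis by (rule order_tendstoD) simp
  qed
  let ?M = "(\<bar>r a\<bar> + 1) + (\<bar>s a\<bar> + 1) + (\<bar>t a\<bar> + 1)"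
  have "\<forall>\<^sub>F x in nhds a. \<bar>beval p x - beval p a - grad p a \<bullet> (x - a)\<bar> \<le> ?M * (norm (x - a))\<^sup>2"
    using bd[OF cont(1)] bd[OF cont(2)] bd[OF cont(3)]
  proof eventually_elim
    case (elim x)
    define u v where "u = fst x - fst a" and "v = snd x - snd a"
    have n: "(norm (x - a))\<^sup>2 = u\<^sup>2 + v\<^sup>2"
      by (simp add: norm_prod_def u_def v_def)
    have "\<bar>u * v\<bar> \<le> u\<^sup>2 + v\<^sup>2"
      using zero_le_power2[of "u + v"] zero_le_power2[of "u - v"] zero_le_power2[of u] zero_le_power2[of v]
      unfolding power2_sum power2_diff mult.assoc by linarith
    moreover have prod_le: "\<bar>c * e\<bar> \<le> (u\<^sup>2 + v\<^sup>2) * B" if "\<bar>c\<bar> \<le> u\<^sup>2 + v\<^sup>2" "\<bar>e\<bar> < B" for c e B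
      unfolding abs_mult by (rule mult_mono) (use that in auto)
    ultimately have "\<bar>u\<^sup>2 * r x\<bar> \<le> (u\<^sup>2 + v\<^sup>2) * (\<bar>r a\<bar> + 1)" "\<bar>u * v * s x\<bar> \<le> (u\<^sup>2 + v\<^sup>2) * (\<bar>s a\<bar> + 1)"
      "\<bar>v\<^sup>2 * t x\<bar> \<le> (u\<^sup>2 + v\<^sup>2) * (\<bar>t a\<bar> + 1)"
      using elim by (simp_all add: prod_le)
    then have "\<bar>u\<^sup>2 * r x + u * v * s x + v\<^sup>2 * t x\<bar> \<le>
        (u\<^sup>2 + v\<^sup>2) * (\<bar>r a\<bar> + 1) + (u\<^sup>2 + v\<^sup>2) * (\<bar>s a\<bar> + 1) + (u\<^sup>2 + v\<^sup>2) * (\<bar>t a\<bar> + 1)"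
      by linarith
    also have "\<dots> = ?M * (u\<^sup>2 + v\<^sup>2)" by (simp add: algebra_simps)
    finally have "\<bar>u\<^sup>2 * r x + u * v * s x + v\<^sup>2 * t x\<bar> \<le> ?M * (u\<^sup>2 + v\<^sup>2)" .
    moreover have "beval p x - beval p a - grad p a \<bullet> (x - a) = u\<^sup>2 * r x + u * v * s x + v\<^sup>2 * t x"
      by (subst p) (simp add: u_def v_def)
    ultimately show ?case by (simp add: n)
  qed
  moreover have "?M > 0" by simp
  ultimately show ?thesis by blast
qed

section \<open>Affine points in homogeneous coordinates\<close>

lemma inj_hom: "inj hom"
  by (rule injI) (simp add: hom_def prod_eq_iff)

lemma vprod_hom:
  assumes "a \<noteq> b"
  shows "vprod (hom a) (hom b) \<noteq> 0"
  using assms by (auto simp: vprod_def hom_def zero_prod_def prod_eq_iff)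

lemma det3_hom_eq_0_imp_collinear:
  assumes "a \<noteq> b" "det3 (hom a) (hom b) (hom c) = 0"
  shows "\<exists>t. c = a + t *\<^sub>R (b - a)"
proof -
  obtain a1 a2 b1 b2 c1 c2 where v: "a = (a1, a2)" "b = (b1, b2)" "c = (c1, c2)"
    by (metis surj_pair)
  have d: "(b1 - a1) * (c2 - a2) = (b2 - a2) * (c1 - a1)"
    using assms(2) by (simp add: v det3_def vprod_def hom_def algebra_simps)
  show ?thesis
  proof (cases "b1 = a1")
    case True
    then have "b2 \<noteq> a2" using assms(1) v by simp
    then show ?thesis using d True
      by (intro exI[of _ "(c2 - a2) / (b2 - a2)"]) (simp add: v)
  next
    case False
    then show ?thesis using d
      by (intro exI[of _ "(c1 - a1) / (b1 - a1)"]) (simp add: v field_simps)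
  qed
qed

lemma collinear_of_det3:
  assumes "a \<noteq> b" "det3 (hom a) (hom b) (hom c) = 0" "det3 (hom a) (hom b) (hom d) = 0"
  shows "collinear {a, b, c, d}"
proof -
  obtain t u where "c = a + t *\<^sub>R (b - a)" "d = a + u *\<^sub>R (b - a)"
    using det3_hom_eq_0_imp_collinear assms by metis
  then have "\<exists>k. x = a + k *\<^sub>R (b - a)" if "x \<in> {a, b, c, d}" for x
    using that by (auto intro: exI[of _ 0] exI[of _ 1])
  then show ?thesis unfolding collinear_alt by blast
qed

lemma general_position_hom:
  assumes "\<And>B. B \<subseteq> A \<Longrightarrow> card B = 4 \<Longrightarrow> \<not> collinear B"
  shows "general_position (hom ` A)"
proof -
  have "det3 (hom a) (hom b) (hom c) \<noteq> 0 \<or> det3 (hom a) (hom b) (hom d) \<noteq> 0"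
    if "{a, b, c, d} \<subseteq> A" "distinct [a, b, c, d]" for a b c d
    using collinear_of_det3[of a b c d] assms[OF that(1)] that(2) by auto
  then show ?thesis
    unfolding general_position_def using vprod_hom inj_eq[OF inj_hom] by simp
qed

section \<open>Seven points off every conic\<close>

text \<open>The hypotheses in homogeneous form; \<open>seven_pointsI\<close> derives them from the
  affine ones.\<close>

locale seven_points =
  fixes A :: "(real \<times> real) set"
  assumes card: "card A = 7"
    and gp: "general_position (hom ` A)"
    and no_conic: "\<And>f. f \<in> polys_upto 2 \<Longrightarrow> \<forall>x\<in>hom ` A. hev 2 f x = 0 \<Longrightarrow> f = 0"
begin

lemma card_hom: "card (hom ` A) = 7"
  using card card_image[OF inj_on_subset[OF inj_hom subset_UNIV]] by metis

lemma finite_A: "finite A"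
  using card by (simp add: card_ge_0_finite)

lemma I13_iff: "f \<in> I13 A \<longleftrightarrow> f \<in> polys_upto 3 \<and> (\<forall>x\<in>hom ` A. hev 3 f x = 0)"
  by (auto simp: I13_def hev_hom polys_upto_def)

lemma I13_polys_upto: "f \<in> I13 A \<Longrightarrow> f \<in> polys_upto 3"
  by (simp add: I13_iff)

lemma subspace_I13: "bpoly.subspace (I13 A)"
proof -
  have "I13 A = {f\<in>polys_upto 3. \<forall>\<phi>\<in>(\<lambda>x f. hev 3 f x) ` hom ` A. \<phi> f = 0}"
    by (simp add: I13_iff set_eq_iff)
  also have "bpoly.subspace \<dots>"
    by (rule subspace_kernel[OF subspace_polys_upto]) (use lin_hev in blast)
  finally show ?thesis .
qed

lemma dim_bound_I13: "dim_bound (I13 A) 3"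
proof -
  have "I13 A = {f\<in>polys_upto 3. \<forall>x\<in>hom ` A. hev 3 f x = 0}"
    by (simp add: I13_iff set_eq_iff)
  then show ?thesis using dim_bound_cubics[OF gp card_hom] by simp
qed

text \<open>Since \<open>w\<close> is any projective point outside \<open>A\<close>, this serves
  both for \<open>extra_zeros\<close> and for positivity at infinity.\<close>

lemma cubic_nonvanishing:
  assumes "\<And>a. a \<in> A \<Longrightarrow> vprod w (hom a) \<noteq> 0"
  shows "\<exists>f\<in>I13 A. hev 3 f w \<noteq> 0"
proof -
  have "vprod w p \<noteq> 0" if "p \<in> hom ` A" for p
    using that assms by (elim imageE) simp
  from cubic_avoiding[OF gp card_hom this no_conic] show ?thesis
    unfolding I13_iff Bex_def by metis
qed

lemma extra_zeros_empty: "extra_zeros A = {}"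
proof -
  have "\<exists>h\<in>I13 A. beval h a \<noteq> 0" if "a \<notin> A" for a
  proof -
    have "vprod (hom a) (hom b) \<noteq> 0" if "b \<in> A" for b
      using that \<open>a \<notin> A\<close> by (intro vprod_hom) auto
    then obtain f where "f \<in> I13 A" "hev 3 f (hom a) \<noteq> 0"
      using cubic_nonvanishing[of "hom a"] by blast
    then show ?thesis using hev_hom[OF I13_polys_upto] by metis
  qed
  then show ?thesis unfolding extra_zeros_def by blast
qed

text \<open>
  \<open>(fst v, snd v, 0)\<close> is the point at infinity in direction \<open>v\<close>, so the determinant says that
  \<open>q\<close> is not on the line through \<open>a\<close> in direction \<open>v\<close>.
\<close>

lemma conic_omitting_off_tangent:
  assumes "a \<in> A" "q \<in> A" "a \<noteq> q" "det3 (fst v, snd v, 0) (hom a) (hom q) \<noteq> 0"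
    and flat: "\<And>h. h \<in> I13 A \<Longrightarrow> v \<bullet> grad h a = 0"
  shows "\<exists>f. f \<in> polys_upto 2 \<and> f \<noteq> 0 \<and> (\<forall>x\<in>hom ` A - {hom q}. hev 2 f x = 0)"
proof -
  have ne: "hom a \<noteq> hom q" using assms(3) inj_eq[OF inj_hom] by simp
  then have "card (hom ` A - {hom a, hom q}) \<le> 5"
    using assms(1,2) card_hom by (subst card_Diff_subset) auto
  then obtain f where f: "f \<in> polys_upto 2" "f \<noteq> 0" "\<forall>x\<in>hom ` A - {hom a, hom q}. hev 2 f x = 0"
    using conic_exists[of "hom ` A - {hom a, hom q}"] finite_A by blast
  define l where "l = linform (vprod (hom a) (hom q))"
  have "hev 3 (l * f) x = 0" if "x \<in> hom ` A" for x
    using f that by (cases "x = hom a"; cases "x = hom q")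
      (simp_all add: l_def hev_linform_mult flip: det3_def)
  then have "l * f \<in> I13 A"
    using hev_linform_mult(1)[OF f(1)] unfolding I13_iff l_def by blast
  then have "v \<bullet> grad (l * f) a = 0" by (rule flat)
  \<comment> \<open>In the product rule for \<open>l * f\<close> only the term
    \<open>beval f a\<close> times the gradient of \<open>l\<close> survives.\<close>
  moreover have "beval l a = 0"
    using hev_hom[OF linform_polys_upto] hev_linform det3_refl(2) unfolding l_def det3_def by metis
  ultimately have "beval f a * (v \<bullet> grad l a) = 0"
    by (simp add: grad_mult)
  moreover have "v \<bullet> grad l a = det3 (fst v, snd v, 0) (hom a) (hom q)"
    by (simp add: l_def grad_linform vprod_def hom_def det3_def inner_prod_def algebra_simps)
  ultimately have "beval f a = 0"
    using assms(4) by (metis mult_eq_0_iff)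
  then have "hev 2 f (hom a) = 0" using hev_hom[OF f(1)] by metis
  then have "hev 2 f x = 0" if "x \<in> hom ` A - {hom q}" for x
    using f(3) that by (cases "x = hom a") simp_all
  then show ?thesis using f(1,2) by blast
qed

text \<open>Otherwise, for \<open>q\<close> off the line through \<open>a\<close> in direction
  \<open>v\<close>, there is a conic through \<open>A - {q}\<close>. Two such points yield a conic
  through all of \<open>A\<close>.\<close>

lemma gradient_nonzero_along:
  assumes a: "a \<in> A" and v: "v \<noteq> 0"
  shows "\<exists>h\<in>I13 A. v \<bullet> grad h a \<noteq> 0"
proof (rule ccontr)
  assume "\<not> ?thesis"
  then have flat: "v \<bullet> grad h a = 0" if "h \<in> I13 A" for h using that by blast
  define w where "w = (fst v, snd v, 0::real)"
  have w: "vprod w p \<noteq> 0" if "p \<in> hom ` A" for p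
    using that v by (auto simp: w_def vprod_def hom_def zero_prod_def prod_eq_iff)
  \<comment> \<open>The line through \<open>a\<close> in direction \<open>v\<close> contains at most
    three points of \<open>A\<close>, one of them \<open>a\<close>, so it misses one of any three
    others.\<close>
  have sel: "\<exists>q\<in>B. det3 w (hom a) (hom q) \<noteq> 0" if B: "B \<subseteq> A - {a}" "3 \<le> card B" for B
  proof -
    have "finite B" using B(2) by (metis card.infinite not_numeral_le_zero)
    obtain C where "C \<subseteq> B" "card C = 3"
      using obtain_subset_with_card_n[OF B(2)] by metis
    then obtain b c d where C: "C = {b, c, d}" "distinct [b, c, d]" by (auto simp: card_3_iff)
    have "{hom a, hom b, hom c, hom d} \<subseteq> hom ` A" "distinct [hom a, hom b, hom c, hom d]"
      using a B(1) C \<open>C \<subseteq> B\<close> by (auto simp: inj_eq[OF inj_hom])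
    then have "\<not> (det3 w (hom a) (hom b) = 0 \<and> det3 w (hom a) (hom c) = 0 \<and> det3 w (hom a) (hom d) = 0)"
      using det3_pencil_card[OF gp card_hom w] by blast
    then show ?thesis using C(1) \<open>C \<subseteq> B\<close> by blast
  qed
  have "card (A - {a}) = 6" using card a by simp
  then obtain q where q: "q \<in> A - {a}" "det3 w (hom a) (hom q) \<noteq> 0"
    using sel[of "A - {a}"] by auto
  have "card (A - {a, q}) = 5" using card a q(1) by (subst card_Diff_subset) auto
  moreover have "A - {a, q} \<subseteq> A - {a}" by blast
  ultimately obtain r where r: "r \<in> A - {a, q}" "det3 w (hom a) (hom r) \<noteq> 0"
    using sel[of "A - {a, q}"] by auto
  obtain f where f: "f \<in> polys_upto 2" "f \<noteq> 0" "\<forall>x\<in>hom ` A - {hom q}. hev 2 f x = 0"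
    using conic_omitting_off_tangent[OF a _ _ _ flat] q unfolding w_def by blast
  obtain g where g: "g \<in> polys_upto 2" "g \<noteq> 0" "\<forall>x\<in>hom ` A - {hom r}. hev 2 g x = 0"
    using conic_omitting_off_tangent[OF a _ _ _ flat] r unfolding w_def by blast
  have "\<forall>x\<in>hom ` A. hev 2 f x = 0"
    by (rule conic_vanishing_everywhere[OF _ _ _ gp card_hom f g])
      (use q r in \<open>auto simp: inj_eq[OF inj_hom]\<close>)
  then show False using no_conic f(1,2) by blast
qed

lemma full_A: "full A"
  unfolding full_def
proof (intro ballI allI)
  fix a and v :: "real \<times> real" assume a: "a \<in> A"
  obtain h where h: "h \<in> I13 A" "(1, 0) \<bullet> grad h a \<noteq> 0"
    using gradient_nonzero_along[OF a, of "(1, 0)"] by (auto simp: zero_prod_def)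
  obtain h1 h2 where h12: "grad h a = (h1, h2)" by (metis surj_pair)
  have "h1 \<noteq> 0" using h(2) h12 by simp
  \<comment> \<open>\<open>(- h2, h1)\<close> is perpendicular to \<open>grad h a\<close>, so the
    gradients of \<open>h\<close> and \<open>k\<close> form a basis of the plane.\<close>
  then obtain k where k: "k \<in> I13 A" "(- h2, h1) \<bullet> grad k a \<noteq> 0"
    using gradient_nonzero_along[OF a, of "(- h2, h1)"] by (auto simp: zero_prod_def)
  obtain k1 k2 where k12: "grad k a = (k1, k2)" by (metis surj_pair)
  define D where "D = h1 * k2 - h2 * k1"
  have "D \<noteq> 0" using k(2) k12 by (simp add: D_def)
  \<comment> \<open>Coordinates of the target vector in this basis, by Cramer's rule.\<close>
  define s t where "s = (fst v * k2 - snd v * k1) / D" and "t = (h1 * snd v - h2 * fst v) / D"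
  have "s * h1 + t * k1 = (fst v * (h1 * k2 - h2 * k1)) / D"
    unfolding s_def t_def by (simp add: add_divide_distrib[symmetric] algebra_simps)
  moreover have "s * h2 + t * k2 = (snd v * (h1 * k2 - h2 * k1)) / D"
    unfolding s_def t_def by (simp add: add_divide_distrib[symmetric] algebra_simps)
  ultimately have "grad (bscale s h + bscale t k) a = v"
    using \<open>D \<noteq> 0\<close> by (simp add: grad_add grad_bscale h12 k12 prod_eq_iff flip: D_def)
  moreover have "bscale s h + bscale t k \<in> I13 A"
    using h(1) k(1) subspace_I13 bpoly.subspace_add bpoly.subspace_scale by blast
  ultimately show "\<exists>h\<in>I13 A. grad h a = v" by blast
qed

end

lemma seven_pointsI:
  assumes "card A = 7" "\<And>B. B \<subseteq> A \<Longrightarrow> card B = 4 \<Longrightarrow> \<not> collinear B" "\<not> on_quadratic A"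
  shows "seven_points A"
proof
  show "general_position (hom ` A)" by (rule general_position_hom[OF assms(2)])
  show "f = 0" if "f \<in> polys_upto 2" "\<forall>x\<in>hom ` A. hev 2 f x = 0" for f
    using that assms(3) hev_hom[OF that(1)] unfolding on_quadratic_def polys_upto_def by auto
qed (fact assms(1))

section \<open>Sums of squares and dimension counts\<close>

lemma polys_upto_square: "p \<in> polys_upto d \<Longrightarrow> p\<^sup>2 \<in> polys_upto (2 * d)"
  using polys_upto_mult[of p d p d] by (simp add: power2_eq_square mult_2)

lemma hev_square: "p \<in> polys_upto d \<Longrightarrow> hev (2 * d) (p\<^sup>2) w = (hev d p w)\<^sup>2"
  using hev_mult[of p d p d] by (simp add: power2_eq_square mult_2)

lemma polys_upto_sum: "(\<And>i. i \<in> I \<Longrightarrow> f i \<in> polys_upto d) \<Longrightarrow> (\<Sum>i\<in>I. f i) \<in> polys_upto d"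
  by (rule bpoly.subspace_sum[OF subspace_polys_upto])

lemma hev_at_infinity:
  "hev n p (x, y, 0) = (\<Sum>j\<le>n. coeff (coeff p j) (n - j) * x ^ (n - j) * y ^ j)"
proof -
  have "(\<Sum>i\<le>n - j. coeff (coeff p j) i * x ^ i * y ^ j * 0 ^ (n - (i + j))) =
      (\<Sum>i\<le>n - j. if i = n - j then coeff (coeff p j) i * x ^ i * y ^ j else 0)" if "j \<le> n" for j
    using that by (intro sum.cong refl) (auto simp: power_0_left)
  then show ?thesis unfolding hev_def by (intro sum.cong refl) simp
qed

lemma hev_at_infinity_eq_0: "p \<in> polys_upto d \<Longrightarrow> d < e \<Longrightarrow> hev e p (x, y, 0) = 0"
  unfolding hev_at_infinity by (rule sum.neutral) (auto simp: polys_upto_iff)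

text \<open>At \<open>x = 1\<close> the form of degree \<open>Suc m\<close> is a polynomial in
  \<open>y\<close> that vanishes identically, so its coefficients are zero.\<close>

lemma polys_upto_pred:
  assumes q: "q \<in> polys_upto (Suc m)" and z: "\<And>y. hev (Suc m) q (1, y, 0) = 0"
  shows "q \<in> polys_upto m"
proof -
  have "\<forall>y. (\<Sum>j\<le>Suc m. coeff (coeff q j) (Suc m - j) * y ^ j) = 0"
    using z unfolding hev_at_infinity by simp
  then have top: "coeff (coeff q j) (Suc m - j) = 0" if "j \<le> Suc m" for j
    using that polyfun_eq_0[of "\<lambda>j. coeff (coeff q j) (Suc m - j)" "Suc m"] by blast
  have "coeff (coeff q j) i = 0" if "m < i + j" for i j
  proof (cases "i + j = Suc m")
    case True
    then show ?thesis using top[of j] by (metis add_diff_cancel_right' le_add2)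
  next
    case False
    then show ?thesis using q that unfolding polys_upto_iff by auto
  qed
  then show ?thesis unfolding polys_upto_iff by blast
qed

text \<open>Real leading forms of squares cannot cancel: the squares of the top forms sum to zero,
  so each form vanishes. The degree bound descends by one at a time from a crude common
  bound.\<close>

lemma sum_of_squares_polys_upto:
  assumes "finite I" "(\<Sum>i\<in>I. (q i)\<^sup>2) \<in> polys_upto (2 * d)" "i \<in> I"
  shows "q i \<in> polys_upto d"
proof -
  have step: "\<forall>i\<in>I. q i \<in> polys_upto (d + k)" if "\<forall>i\<in>I. q i \<in> polys_upto (d + Suc k)" for k
  proof
    fix i assume i: "i \<in> I"
    have top: "hev (Suc (d + k)) (q i) (1, y, 0) = 0" for y
    proof -
      have "(\<Sum>i\<in>I. (hev (Suc (d + k)) (q i) (1, y, 0))\<^sup>2) = hev (2 * Suc (d + k)) (\<Sum>i\<in>I. (q i)\<^sup>2) (1, y, 0)"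
        unfolding hev_sum using that by (intro sum.cong refl hev_square[symmetric]) auto
      also have "\<dots> = 0" using assms(2) by (rule hev_at_infinity_eq_0) simp
      finally show ?thesis using i assms(1) by (simp add: sum_nonneg_eq_0_iff)
    qed
    have "q i \<in> polys_upto (Suc (d + k))" using that i by simp
    then show "q i \<in> polys_upto (d + k)" using top by (rule polys_upto_pred)
  qed
  have "(\<forall>i\<in>I. q i \<in> polys_upto (d + k)) \<longrightarrow> (\<forall>i\<in>I. q i \<in> polys_upto d)" for k
    by (induction k) (use step in auto)
  moreover have "q i \<in> polys_upto (d + (\<Sum>i\<in>I. total_degree (q i)))" if "i \<in> I" for i
    using that assms(1) member_le_sum[of i I "\<lambda>i. total_degree (q i)"]
    by (simp add: polys_upto_def)
  ultimately show ?thesis using assms(3) by blast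
qed

section \<open>Products of cubics and dimension counts\<close>

lemma I13_sq_eq_span: "I13_sq A = bpoly.span {h * k |h k. h \<in> I13 A \<and> k \<in> I13 A}" (is "_ = bpoly.span ?P")
proof
  show "I13_sq A \<subseteq> bpoly.span ?P"
  proof
    fix f assume "f \<in> I13_sq A"
    then obtain n :: nat and h k where hk: "\<forall>i<n. h i \<in> I13 A \<and> k i \<in> I13 A" "f = (\<Sum>i<n. h i * k i)"
      unfolding I13_sq_def by blast
    show "f \<in> bpoly.span ?P"
      unfolding hk(2) by (intro bpoly.span_sum bpoly.span_base) (use hk(1) in blast)
  qed
next
  \<comment> \<open>Being the span of a basis, \<open>I13 A\<close> is a subspace, here for
    arbitrary \<open>A\<close>.\<close>
  obtain H where "bpoly.span H = I13 A" using I13_basis_exists unfolding basis_of_def by blast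
  then have sub: "bpoly.subspace (I13 A)" using bpoly.subspace_span by metis
  show "bpoly.span ?P \<subseteq> I13_sq A"
  proof
    fix f assume "f \<in> bpoly.span ?P"
    then show "f \<in> I13_sq A"
    proof (induction rule: bpoly.span_induct_alt)
      case base
      show ?case unfolding I13_sq_def by (auto intro: exI[of _ 0])
    next
      case (step c p f)
      from step obtain h' k' where hk': "p = h' * k'" "h' \<in> I13 A" "k' \<in> I13 A" by blast
      from step obtain n :: nat and h k where hk: "\<forall>i<n. h i \<in> I13 A \<and> k i \<in> I13 A" "f = (\<Sum>i<n. h i * k i)"
        unfolding I13_sq_def by blast
      have "(\<Sum>i<n. (h(n := bscale c h')) i * (k(n := k')) i) = f"
        unfolding hk(2) by (intro sum.cong) auto
      then have "bscale c p + f = (\<Sum>i<Suc n. (h(n := bscale c h')) i * (k(n := k')) i)"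
        by (simp add: hk'(1) bscale_def)
      moreover have "\<forall>i<Suc n. (h(n := bscale c h')) i \<in> I13 A \<and> (k(n := k')) i \<in> I13 A"
        using hk(1) hk'(2,3) bpoly.subspace_scale[OF sub] by (auto simp: less_Suc_eq)
      ultimately show ?case unfolding I13_sq_def by blast
    qed
  qed
qed

lemma mult_mem_span:
  assumes "h \<in> bpoly.span S" "k \<in> bpoly.span T"
  shows "h * k \<in> bpoly.span {s * t |s t. s \<in> S \<and> t \<in> T}" (is "_ \<in> bpoly.span ?P")
  using assms(1)
proof (induction rule: bpoly.span_induct_alt)
  case base
  show ?case by (simp add: bpoly.span_zero)
next
  case (step c s h)
  have "s * k \<in> bpoly.span ?P"
    using assms(2)
  proof (induction rule: bpoly.span_induct_alt)
    case base
    show ?case by (simp add: bpoly.span_zero)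
  next
    case (step d t k)
    have "s * t \<in> bpoly.span ?P" using \<open>s \<in> S\<close> step(1) by (intro bpoly.span_base) blast
    then have "bscale d (s * t) + s * k \<in> bpoly.span ?P"
      using step by (intro bpoly.span_add bpoly.span_scale) auto
    moreover have "bscale d (s * t) + s * k = s * (bscale d t + k)"
      by (simp add: bscale_def distrib_left)
    ultimately show ?case by simp
  qed
  then have "bscale c (s * k) + h * k \<in> bpoly.span ?P"
    using step by (intro bpoly.span_add bpoly.span_scale) auto
  moreover have "bscale c (s * k) + h * k = (bscale c s + h) * k"
    by (simp add: bscale_def distrib_right)
  ultimately show ?case by simp
qed

text \<open>Three generators have six products up to order.\<close>

lemma dim_bound_I13_sq:
  assumes "dim_bound (I13 A) 3"
  shows "dim_bound (I13_sq A) 6"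
proof -
  obtain T where T: "finite T" "card T \<le> 3" "I13 A \<subseteq> bpoly.span T"
    using assms unfolding dim_bound_def by blast
  \<comment> \<open>\<open>T\<close> may have fewer than three elements; \<open>a\<close>,
    \<open>b\<close>, \<open>c\<close> may then coincide or lie outside \<open>T\<close>.\<close>
  obtain a b c where abc: "T \<subseteq> {a, b, c}"
  proof -
    obtain xs where xs: "set xs = T" "length xs \<le> 3"
      using finite_distinct_list[OF T(1)] T(2) distinct_card by metis
    then have "set xs \<subseteq> {xs ! 0, xs ! 1, xs ! 2}"
      by (auto simp: in_set_conv_nth less_Suc_eq numeral_eq_Suc le_Suc_eq)
    then show thesis using that xs(1) by blast
  qed
  have "{h * k |h k. h \<in> I13 A \<and> k \<in> I13 A} \<subseteq> bpoly.span {s * t |s t. s \<in> T \<and> t \<in> T}"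
    using mult_mem_span T(3) by blast
  then have "I13_sq A \<subseteq> bpoly.span {s * t |s t. s \<in> T \<and> t \<in> T}"
    unfolding I13_sq_eq_span by (rule bpoly.span_minimal) (rule bpoly.subspace_span)
  also have "\<dots> \<subseteq> bpoly.span {a * a, a * b, a * c, b * b, b * c, c * c}"
  proof (intro bpoly.span_mono subsetI)
    fix f assume "f \<in> {s * t |s t. s \<in> T \<and> t \<in> T}"
    then obtain s t where "f = s * t" "s \<in> {a, b, c}" "t \<in> {a, b, c}" using abc by blast
    then show "f \<in> {a * a, a * b, a * c, b * b, b * c, c * c}"
      by (elim insertE emptyE) (simp_all add: mult.commute)
  qed
  finally show ?thesis
    unfolding dim_bound_def
    by (intro exI[of _ "{a * a, a * b, a * c, b * b, b * c, c * c}"])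
      (auto intro!: card_insert_le_m1)
qed

text \<open>Three conditions per point are at most 21 in all, and 6 + 21 < 28.\<close>

lemma not_dim_bound_I26:
  assumes "finite A" "card A \<le> 7"
  shows "\<not> dim_bound (I26 A) 6"
proof
  assume "dim_bound (I26 A) 6"
  let ?\<phi> = "\<lambda>a. {\<lambda>p. beval p a, \<lambda>p. beval (partial_x p) a, \<lambda>p. beval (partial_y p) a}"
  let ?\<Phi> = "\<Union>a\<in>A. ?\<phi> a"
  have "I26 A = {p\<in>polys_upto 6. \<forall>\<phi>\<in>?\<Phi>. \<phi> p = 0}"
    by (simp add: I26_def polys_upto_def set_eq_iff)
  then have "dim_bound (polys_upto 6) (6 + card ?\<Phi>)"
    using \<open>dim_bound (I26 A) 6\<close> assms(1)
    by (intro dim_bound_kernelsD) (auto intro: subspace_polys_upto lin_functionals)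
  moreover have "card ?\<Phi> \<le> (\<Sum>a\<in>A. card (?\<phi> a))" by (rule card_UN_le[OF assms(1)])
  moreover have "(\<Sum>a\<in>A. card (?\<phi> a)) \<le> (\<Sum>a\<in>A. 3)"
    by (intro sum_mono) (auto intro!: card_insert_le_m1)
  moreover have "(\<Sum>j\<le>6. Suc (6 - j)) = 28" by (simp add: numeral_eq_Suc)
  ultimately show False
    using not_dim_bound_polys_upto[of "6 + card ?\<Phi>" 6] assms(2) by simp
qed

section \<open>Hilbert's method\<close>

context seven_points
begin

context
  fixes H F
  assumes H: "basis_of H (I13 A)" and F: "F = (\<Sum>h\<in>H. h\<^sup>2)"
begin

lemma finite_basis: "finite H" and basis_subset: "H \<subseteq> I13 A"
  using H bpoly.span_superset unfolding basis_of_def by auto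

lemma basis_polys_upto: "h \<in> H \<Longrightarrow> h \<in> polys_upto 3"
  using basis_subset I13_polys_upto by blast

lemma F_polys_upto: "F \<in> polys_upto 6"
  unfolding F using polys_upto_square[OF basis_polys_upto] by (intro polys_upto_sum) simp

lemma hev_F: "hev 6 F w = (\<Sum>h\<in>H. (hev 3 h w)\<^sup>2)"
  unfolding F hev_sum using hev_square[OF basis_polys_upto] by (intro sum.cong refl) simp

lemma hev_F_nonneg: "0 \<le> hev 6 F w"
  unfolding hev_F by (simp add: sum_nonneg)

lemma beval_F: "beval F a = (\<Sum>h\<in>H. (beval h a)\<^sup>2)"
  unfolding F by simp

text \<open>Cauchy-Schwarz applied to the expansion of \<open>f\<close> in the basis
  \<open>H\<close>.\<close>

lemma hev_square_le_F:
  assumes "f \<in> I13 A"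
  shows "\<exists>C\<ge>0. \<forall>w. (hev 3 f w)\<^sup>2 \<le> C * hev 6 F w"
proof -
  obtain u where u: "f = (\<Sum>h\<in>H. bscale (u h) h)"
    using assms H bpoly.span_finite[OF finite_basis] unfolding basis_of_def by auto
  have "(hev 3 f w)\<^sup>2 \<le> (\<Sum>h\<in>H. (u h)\<^sup>2) * hev 6 F w" for w
    unfolding hev_F u hev_sum hev_bscale by (rule Cauchy_Schwarz_ineq_sum)
  then show ?thesis by (intro exI[of _ "\<Sum>h\<in>H. (u h)\<^sup>2"]) (simp add: sum_nonneg)
qed

lemma hev_F_pos:
  assumes "\<And>a. a \<in> A \<Longrightarrow> vprod w (hom a) \<noteq> 0"
  shows "0 < hev 6 F w"
proof -
  obtain f where "f \<in> I13 A" "hev 3 f w \<noteq> 0" using cubic_nonvanishing[OF assms] by blast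
  then obtain C where "(hev 3 f w)\<^sup>2 \<le> C * hev 6 F w" using hev_square_le_F by blast
  with \<open>hev 3 f w \<noteq> 0\<close> have "hev 6 F w \<noteq> 0" by auto
  then show ?thesis using hev_F_nonneg[of w] by simp
qed

lemma hev_F_pos_at_infinity: "(x, y) \<noteq> (0, 0) \<Longrightarrow> 0 < hev 6 F (x, y, 0)"
  by (rule hev_F_pos) (auto simp: vprod_def hom_def zero_prod_def)

text \<open>\<open>homogenization\<close> uses the actual degree, so a drop below 6 has to be
  excluded; positivity at the point at infinity \<open>(1, 0, 0)\<close> does this.\<close>

lemma total_degree_F: "total_degree F = 6"
proof (rule antisym)
  show "total_degree F \<le> 6" using F_polys_upto by (simp add: polys_upto_def)
  show "6 \<le> total_degree F"
  proof (rule ccontr)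
    assume "\<not> ?thesis"
    then have "F \<in> polys_upto 5" by (simp add: polys_upto_def)
    then have "hev 6 F (1, 0, 0) = 0" by (rule hev_at_infinity_eq_0) simp
    then show False using hev_F_pos_at_infinity[of 1 0] by simp
  qed
qed

lemma no_zero_at_infinity_F: "\<not> has_zero_at_infinity F"
  using hev_F_pos_at_infinity unfolding has_zero_at_infinity_def homogenization_hev total_degree_F
  by (metis less_irrefl)

section \<open>Comparison of \<open>I26 A\<close> with the sum of squares\<close>

lemma beval_square_le_F:
  assumes "f \<in> I13 A"
  shows "\<exists>C\<ge>0. \<forall>x. (beval f x)\<^sup>2 \<le> C * beval F x"
  using hev_square_le_F[OF assms] hev_hom[OF F_polys_upto] hev_hom[OF I13_polys_upto[OF assms]]
  by metis

text \<open>Fullness provides \<open>h\<close> and \<open>k\<close> that agree with the coordinates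
  of \<open>x - a\<close> up to second order. The resulting error, a multiple of
  \<open>norm (x - a) ^ 4\<close>, is absorbed near \<open>a\<close>.\<close>

lemma norm_square_le_F:
  assumes "a \<in> A"
  shows "\<exists>C\<ge>0. \<forall>\<^sub>F x in nhds a. (norm (x - a))\<^sup>2 \<le> C * beval F x"
proof -
  obtain h k where hk: "h \<in> I13 A" "grad h a = (1, 0)" "k \<in> I13 A" "grad k a = (0, 1)"
    using full_A assms unfolding full_def by metis
  have z: "beval h a = 0" "beval k a = 0" using hk assms by (auto simp: I13_def)
  obtain M where M: "M > 0" "\<forall>\<^sub>F x in nhds a. \<bar>beval h x - fst (x - a)\<bar> \<le> M * (norm (x - a))\<^sup>2"
    using beval_linear_approx[where a = a and p = h] hk z by (auto simp: inner_prod_def)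
  obtain N where N: "N > 0" "\<forall>\<^sub>F x in nhds a. \<bar>beval k x - snd (x - a)\<bar> \<le> N * (norm (x - a))\<^sup>2"
    using beval_linear_approx[where a = a and p = k] hk z by (auto simp: inner_prod_def)
  obtain C where C: "C \<ge> 0" "\<And>x. (beval h x)\<^sup>2 \<le> C * beval F x"
    using beval_square_le_F[OF hk(1)] by blast
  obtain D where D: "D \<ge> 0" "\<And>x. (beval k x)\<^sup>2 \<le> D * beval F x"
    using beval_square_le_F[OF hk(3)] by blast
  define K where "K = 2 * (M\<^sup>2 + N\<^sup>2)"
  have "K > 0" using M(1) N(1) by (simp add: K_def add_pos_pos)
  have "((\<lambda>x. K * (norm (x - a))\<^sup>2) \<longlongrightarrow> K * (norm (a - a))\<^sup>2) (nhds a)"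
    by (intro tendsto_intros filterlim_ident)
  then have small: "\<forall>\<^sub>F x in nhds a. K * (norm (x - a))\<^sup>2 < 1 / 2"
    by (rule order_tendstoD) simp
  have "\<forall>\<^sub>F x in nhds a. (norm (x - a))\<^sup>2 \<le> 4 * (C + D) * beval F x"
    using M(2) N(2) small
  proof eventually_elim
    case (elim x)
    define n where "n = (norm (x - a))\<^sup>2"
    have "n \<ge> 0" by (simp add: n_def)
    \<comment> \<open>The estimate
      \<open>t\<^sup>2 \<le> 2 * s\<^sup>2 + 2 * (s - t)\<^sup>2\<close> amounts to
      \<open>0 \<le> (2 * s - t)\<^sup>2\<close>; summing it over both coordinates produces
      \<open>K\<close>.\<close>
    have sq: "t\<^sup>2 \<le> 2 * s\<^sup>2 + 2 * B\<^sup>2 * n\<^sup>2" if "\<bar>s - t\<bar> \<le> B * n" for s t B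
    proof -
      have "(s - t)\<^sup>2 \<le> (B * n)\<^sup>2" using that by (metis abs_ge_zero power2_abs power_mono)
      moreover have "0 \<le> (2 * s - t)\<^sup>2" by simp
      ultimately show ?thesis by (simp add: power2_eq_square algebra_simps)
    qed
    have "n = (fst (x - a))\<^sup>2 + (snd (x - a))\<^sup>2"
      by (simp add: n_def norm_prod_def)
    also have "\<dots> \<le> 2 * ((beval h x)\<^sup>2 + (beval k x)\<^sup>2) + K * n * n"
      using sq[OF elim(1)[folded n_def]] sq[OF elim(2)[folded n_def]]
      by (simp add: K_def algebra_simps power2_eq_square)
    also have "K * n * n \<le> 1 / 2 * n"
      using elim(3) \<open>n \<ge> 0\<close> by (intro mult_right_mono) (simp_all add: n_def)
    finally have "n \<le> 4 * ((beval h x)\<^sup>2 + (beval k x)\<^sup>2)" by simp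
    also have "\<dots> \<le> 4 * (C * beval F x + D * beval F x)"
      using C(2)[of x] D(2)[of x] by simp
    finally show ?case by (simp add: n_def algebra_simps)
  qed
  then show ?thesis using C(1) D(1) by (intro exI[of _ "4 * (C + D)"]) simp
qed

lemma beval_I26_le_F_near:
  assumes g: "g \<in> I26 A" and a: "a \<in> A"
  shows "\<exists>M. \<forall>\<^sub>F x in nhds a. \<bar>beval g x\<bar> \<le> M * beval F x"
proof -
  have "beval g a = 0" "grad g a = 0"
    using g a by (simp_all add: I26_def grad_def zero_prod_def)
  then obtain M where M: "M > 0" "\<forall>\<^sub>F x in nhds a. \<bar>beval g x\<bar> \<le> M * (norm (x - a))\<^sup>2"
    using beval_linear_approx[where a = a and p = g] by auto
  obtain C where C: "\<forall>\<^sub>F x in nhds a. (norm (x - a))\<^sup>2 \<le> C * beval F x"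
    using norm_square_le_F[OF a] by blast
  from M(2) C have "\<forall>\<^sub>F x in nhds a. \<bar>beval g x\<bar> \<le> (M * C) * beval F x"
  proof eventually_elim
    case (elim x)
    have "M * (norm (x - a))\<^sup>2 \<le> M * (C * beval F x)"
      using elim(2) M(1) by (intro mult_left_mono) auto
    then show ?case using elim(1) by (simp add: mult.assoc)
  qed
  then show ?thesis by blast
qed

text \<open>At a point representing some \<open>a\<close> in \<open>A\<close>, the affine bound is
  transported by dehomogenizing, where both sides scale by \<open>z ^ 6\<close>. Elsewhere
  \<open>F\<close> is positive, and continuity suffices.\<close>

lemma hev_I26_le_F_near:
  assumes g: "g \<in> I26 A" and w: "w \<noteq> 0"
  shows "\<exists>M. \<forall>\<^sub>F v in nhds w. \<bar>hev 6 g v\<bar> \<le> M * hev 6 F v"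
proof (cases "\<exists>a\<in>A. vprod w (hom a) = 0")
  case True
  then obtain a where a: "a \<in> A" "vprod w (hom a) = 0" by blast
  obtain x y z where wx: "w = (x, y, z)" by (cases w)
  have "z \<noteq> 0" "x = z * fst a" "y = z * snd a"
    using a(2) w wx by (auto simp: vprod_def hom_def zero_prod_def)
  define \<phi> where "\<phi> v = (fst v / snd (snd v), fst (snd v) / snd (snd v))" for v :: "real \<times> real \<times> real"
  have "\<phi> w = a"
    using \<open>z \<noteq> 0\<close> \<open>x = _\<close> \<open>y = _\<close> by (simp add: \<phi>_def wx)
  have "((\<lambda>v. snd (snd v)) \<longlongrightarrow> snd (snd w)) (nhds w)" by (intro tendsto_intros filterlim_ident)
  then have nz: "\<forall>\<^sub>F v in nhds w. snd (snd v) \<noteq> 0"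
    by (rule tendsto_imp_eventually_ne) (simp add: wx \<open>z \<noteq> 0\<close>)
  have "(\<phi> \<longlongrightarrow> \<phi> w) (nhds w)"
    unfolding \<phi>_def using \<open>z \<noteq> 0\<close> by (intro tendsto_intros filterlim_ident) (simp_all add: wx)
  then have lim: "filterlim \<phi> (nhds a) (nhds w)" using \<open>\<phi> w = a\<close> by simp
  obtain M where M: "\<forall>\<^sub>F u in nhds a. \<bar>beval g u\<bar> \<le> M * beval F u"
    using beval_I26_le_F_near[OF g a(1)] by blast
  have "\<forall>\<^sub>F v in nhds w. \<bar>beval g (\<phi> v)\<bar> \<le> M * beval F (\<phi> v)"
    by (rule eventually_compose_filterlim[OF M lim])
  with nz have "\<forall>\<^sub>F v in nhds w. \<bar>hev 6 g v\<bar> \<le> M * hev 6 F v"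
  proof eventually_elim
    case (elim v)
    obtain x y z where v: "v = (x, y, z)" by (cases v)
    have hv: "hev 6 p v = z ^ 6 * beval p (\<phi> v)" if "p \<in> polys_upto 6" for p
      using hev_eq[OF that] elim(1) by (simp add: v \<phi>_def)
    have g6: "g \<in> polys_upto 6" using g by (simp add: I26_def polys_upto_def)
    have "z ^ 6 * \<bar>beval g (\<phi> v)\<bar> \<le> z ^ 6 * (M * beval F (\<phi> v))"
      using elim(2) by (intro mult_left_mono) simp_all
    then show ?case
      by (simp add: hv[OF g6] hv[OF F_polys_upto] abs_mult algebra_simps)
  qed
  then show ?thesis by blast
next
  case False
  then have pos: "0 < hev 6 F w" by (intro hev_F_pos) blast
  have lim: "(hev 6 p \<longlongrightarrow> hev 6 p w) (nhds w)" for p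
    using continuous_hev[of UNIV 6 p] continuous_on_eq_continuous_at[OF open_UNIV]
    by (metis UNIV_I isCont_def tendsto_nhds_iff)
  have "\<forall>\<^sub>F v in nhds w. hev 6 F w / 2 < hev 6 F v"
    using lim by (rule order_tendstoD) (use pos in simp)
  moreover have "\<forall>\<^sub>F v in nhds w. \<bar>hev 6 g v\<bar> < \<bar>hev 6 g w\<bar> + 1"
    using tendsto_rabs[OF lim] by (rule order_tendstoD) simp
  ultimately have "\<forall>\<^sub>F v in nhds w. \<bar>hev 6 g v\<bar> \<le> (2 * (\<bar>hev 6 g w\<bar> + 1) / hev 6 F w) * hev 6 F v"
  proof eventually_elim
    case (elim v)
    have "(2 * (\<bar>hev 6 g w\<bar> + 1) / hev 6 F w) * (hev 6 F w / 2) \<le> (2 * (\<bar>hev 6 g w\<bar> + 1) / hev 6 F w) * hev 6 F v"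
      using elim(1) pos by (intro mult_left_mono) auto
    moreover have "(2 * (\<bar>hev 6 g w\<bar> + 1) / hev 6 F w) * (hev 6 F w / 2) = \<bar>hev 6 g w\<bar> + 1"
      using pos by simp
    ultimately show ?case using elim(2) by linarith
  qed
  then show ?thesis by blast
qed

text \<open>
  Homogenizing turns the plane together with the line at infinity into the compact unit sphere of
  \<open>\<real>\<^sup>3\<close>, so that local bounds suffice.
\<close>

lemma beval_I26_le_F:
  assumes g: "g \<in> I26 A"
  shows "\<exists>M>0. \<forall>x. \<bar>beval g x\<bar> \<le> M * beval F x"
proof -
  \<comment> \<open>The sets \<open>{v. \<bar>hev 6 g v\<bar> \<le> real n * hev 6 F v}\<close>
    increase with \<open>n\<close> because \<open>F\<close> is nonnegative, so the largest index of
    a finite subcover works on the whole sphere.\<close>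
  define U where "U n = interior {v. \<bar>hev 6 g v\<bar> \<le> real n * hev 6 F v}" for n :: nat
  have openU: "open (U n)" for n by (simp add: U_def)
  have cover: "sphere 0 1 \<subseteq> (\<Union>n\<in>UNIV. U n)"
  proof
    fix w :: "real \<times> real \<times> real" assume "w \<in> sphere 0 1"
    then have "w \<noteq> 0" by auto
    then obtain M where M: "\<forall>\<^sub>F v in nhds w. \<bar>hev 6 g v\<bar> \<le> M * hev 6 F v"
      using hev_I26_le_F_near[OF g] by blast
    obtain n :: nat where n: "M \<le> real n" using real_arch_simple by blast
    from M have "\<forall>\<^sub>F v in nhds w. \<bar>hev 6 g v\<bar> \<le> real n * hev 6 F v"
    proof eventually_elim
      case (elim v)
      then show ?case
        using mult_right_mono[OF n hev_F_nonneg[of v]] by linarith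
    qed
    then show "w \<in> (\<Union>n\<in>UNIV. U n)"
      unfolding U_def by (auto simp: eventually_nhds interior_def)
  qed
  obtain C where C: "finite C" "sphere 0 1 \<subseteq> (\<Union>n\<in>C. U n)"
    by (rule compactE_image[OF compact_sphere openU cover])
  \<comment> \<open>Inserting 0 keeps \<open>Max\<close> meaningful for empty \<open>C\<close>, and
    \<open>Suc\<close> makes \<open>M\<close> positive.\<close>
  define M where "M = real (Suc (Max (insert 0 C)))"
  have sphere: "\<bar>hev 6 g w\<bar> \<le> M * hev 6 F w" if w: "w \<in> sphere 0 1" for w
  proof -
    obtain n where n: "n \<in> C" "w \<in> U n" using C(2) w by blast
    then have "w \<in> {v. \<bar>hev 6 g v\<bar> \<le> real n * hev 6 F v}" unfolding U_def by (metis interior_subset subsetD)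
    then have "\<bar>hev 6 g w\<bar> \<le> real n * hev 6 F w" by simp
    moreover have "n \<le> Max (insert 0 C)" using n(1) C(1) by simp
    then have "real n \<le> M" by (simp add: M_def)
    ultimately show ?thesis using mult_right_mono[OF _ hev_F_nonneg[of w], of "real n" M] by linarith
  qed
  have "\<bar>beval g x\<bar> \<le> M * beval F x" for x
  proof -
    define r where "r = norm (hom x)"
    have "r > 0" by (simp add: r_def hom_def zero_prod_def)
    have hv: "hev 6 p ((1 / r) *\<^sub>R hom x) = (1 / r) ^ 6 * beval p x" if "p \<in> polys_upto 6" for p
      using hev_eq[OF that, of "1 / r"] \<open>r > 0\<close> by (simp add: hom_def)
    have "(1 / r) *\<^sub>R hom x \<in> sphere 0 1"
      using \<open>r > 0\<close> by (simp add: r_def)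
    then have "(1 / r) ^ 6 * \<bar>beval g x\<bar> \<le> (1 / r) ^ 6 * (M * beval F x)"
      using sphere[of "(1 / r) *\<^sub>R hom x"] hv[OF F_polys_upto] hv[of g] g \<open>r > 0\<close>
      by (simp add: abs_mult I26_def polys_upto_def algebra_simps)
    then show ?thesis using \<open>r > 0\<close> by (simp add: mult_le_cancel_left_pos)
  qed
  moreover have "M > 0" by (simp add: M_def)
  ultimately show ?thesis by blast
qed

section \<open>The perturbed sum of squares\<close>

text \<open>In a representation by squares each \<open>q i\<close> has degree at most 3 and vanishes
  on \<open>A\<close>, where \<open>F\<close> and \<open>g\<close> do. So all \<open>q i\<close> lie
  in \<open>I13 A\<close>, and subtracting \<open>F\<close> would place \<open>g\<close> in
  \<open>I13_sq A\<close>.\<close>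

lemma not_sos_perturbation:
  assumes g: "g \<in> I26 A" "g \<notin> I13_sq A" and "c \<noteq> 0"
  shows "\<not> sos (F + bscale c g)"
proof
  assume "sos (F + bscale c g)"
  then obtain n :: nat and q where q: "F + bscale c g = (\<Sum>i<n. (q i)\<^sup>2)"
    unfolding sos_def by blast
  have "bscale c g \<in> polys_upto 6"
    using g(1) bpoly.subspace_scale[OF subspace_polys_upto] by (simp add: I26_def polys_upto_def)
  then have "F + bscale c g \<in> polys_upto (2 * 3)"
    using bpoly.subspace_add[OF subspace_polys_upto F_polys_upto] by simp
  then have q3: "q i \<in> polys_upto 3" if "i < n" for i
    using sum_of_squares_polys_upto[of "{..<n}" q 3 i] that unfolding q by simp
  have qI: "q i \<in> I13 A" if "i < n" for i
  proof -
    have "beval (q i) a = 0" if a: "a \<in> A" for a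
    proof -
      have "beval h a = 0" if "h \<in> H" for h
        using that a basis_subset by (auto simp: I13_def)
      then have "beval F a = 0" unfolding beval_F by (simp add: sum.neutral)
      moreover have "beval g a = 0" using g(1) a by (simp add: I26_def)
      ultimately have "(\<Sum>i<n. (beval (q i) a)\<^sup>2) = 0"
        using arg_cong[OF q, of "\<lambda>p. beval p a"] by simp
      then show ?thesis using \<open>i < n\<close> by (simp add: sum_nonneg_eq_0_iff)
    qed
    then show ?thesis using q3[OF that] by (simp add: I13_def polys_upto_def)
  qed
  let ?P = "{h * k |h k. h \<in> I13 A \<and> k \<in> I13 A}"
  have sq: "h\<^sup>2 \<in> bpoly.span ?P" if "h \<in> I13 A" for h
    unfolding power2_eq_square using that by (intro bpoly.span_base) blast
  have "(\<Sum>i<n. (q i)\<^sup>2) \<in> bpoly.span ?P" by (rule bpoly.span_sum) (simp add: sq qI)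
  moreover have "F \<in> bpoly.span ?P"
    unfolding F using basis_subset by (intro bpoly.span_sum sq) blast
  ultimately have "(\<Sum>i<n. (q i)\<^sup>2) - F \<in> bpoly.span ?P" by (rule bpoly.span_diff)
  then have "bscale c g \<in> bpoly.span ?P" unfolding q[symmetric] by simp
  then have "bscale (1 / c) (bscale c g) \<in> bpoly.span ?P" by (rule bpoly.span_scale)
  then show False using g(2) \<open>c \<noteq> 0\<close> unfolding I13_sq_eq_span by simp
qed

text \<open>The global bound with constant \<open>M\<close> permits
  \<open>c = 1 / M\<close>.\<close>

lemma psd_perturbation:
  assumes "g \<in> I26 A"
  shows "\<exists>c>0. psd (F + bscale c g)"
proof -
  obtain M where M: "M > 0" "\<And>x. \<bar>beval g x\<bar> \<le> M * beval F x"
    using beval_I26_le_F[OF assms] by blast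
  have "0 \<le> beval (F + bscale (1 / M) g) x" for x
  proof -
    have "\<bar>beval g x\<bar> / M \<le> beval F x"
      using M by (simp add: divide_le_eq mult.commute)
    moreover have "- (beval g x / M) \<le> \<bar>beval g x\<bar> / M"
      using M(1) divide_right_mono[of "- beval g x" "\<bar>beval g x\<bar>" M] by simp
    ultimately show ?thesis by simp
  qed
  then show ?thesis using M(1) by (intro exI[of _ "1 / M"]) (simp add: psd_def)
qed

end

text \<open>An inclusion of \<open>I26 A\<close> in \<open>I13_sq A\<close> would bound the
  dimension of \<open>I26 A\<close> by 6.\<close>

lemma exists_I26_not_I13_sq: "\<exists>g. g \<in> I26 A \<and> g \<notin> I13_sq A"
  using not_dim_bound_I26[OF finite_A] dim_bound_I13_sq[OF dim_bound_I13] dim_bound_subset card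
  by (metis order_refl subsetI)

lemma hilbert_method: "hilbert_method_applies A"
  unfolding hilbert_method_applies_def
proof (intro allI impI conjI)
  fix H assume H: "basis_of H (I13 A)"
  show "\<not> has_zero_at_infinity (\<Sum>h\<in>H. h\<^sup>2)"
    by (rule no_zero_at_infinity_F[OF H refl])
  obtain g where g: "g \<in> I26 A" "g \<notin> I13_sq A" using exists_I26_not_I13_sq by blast
  obtain c where "c > 0" "psd ((\<Sum>h\<in>H. h\<^sup>2) + bscale c g)"
    using psd_perturbation[OF H refl g(1)] by blast
  moreover have "\<not> sos ((\<Sum>h\<in>H. h\<^sup>2) + bscale c g)"
    using not_sos_perturbation[OF H refl g] \<open>c > 0\<close> by simp
  ultimately show "\<exists>g \<in> I26 A - I13_sq A. (\<forall>w\<in>extra_zeros A. beval g w > 0) \<and>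
      (\<exists>c>0. psd ((\<Sum>h\<in>H. h\<^sup>2) + bscale c g) \<and> \<not> sos ((\<Sum>h\<in>H. h\<^sup>2) + bscale c g))"
    using g extra_zeros_empty by blast
qed (simp_all add: extra_zeros_empty full_A)

end

theorem theorem4p3:
  fixes A :: "(real \<times> real) set"
  assumes "card A = 7"
    and "\<And>B. B \<subseteq> A \<Longrightarrow> card B = 4 \<Longrightarrow> \<not> collinear B"
    and "\<not> on_quadratic A"
  shows "hilbert_method_applies A"
  using seven_points.hilbert_method[OF seven_pointsI] assms by blast

end
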